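(* Consider the triangular array $Y_{n,k}=\mu+\delta_n\mathbf{1}\{k>\tau_n\}+\sigma(k/n)\varepsilon_k$, $k=1,\dots,n$, and suppose Assumptions E, V and C (stated in the context) hold. Under the alternative hypothesis $\mathcal{H}_1$ with $\tau_n=[n\zeta]$ for some $\zeta\in(0,1)$, $$\mathscr{Q}(V_n)\xrightarrow{P}\infty\quad\text{and}\quad\mathscr{R}(V_n)\xrightarrow{P}\infty,\qquad n\to\infty.$$
   Context: Model: for each $n$, $Y_{n,k}=\mu+\delta_n\mathbf{1}\{k>\tau_n\}+\sigma(k/n)\varepsilon_k$, $k=1,\dots,n$, with unknown constants $\mu\in\mathbb{R}$, $\delta_n\in\mathbb{R}$, $\tau_n\in\{1,\dots,n\}$, a strictly stationary centered sequence $\{\varepsilon_k\}$, and a deterministic $\sigma:[0,1]\to(0,\infty)$. Alternative $\mathcal{H}_1:\tau_n<n,\ \delta_n\neq0$. $[x]$ is the integer part. Strong mixing coefficients: $\alpha(n)=\sup_{k}\sup_{A\in\sigma(\varepsilon_1,\dots,\varepsilon_k),B\in\sigma(\varepsilon_{k+n},\varepsilon_{k+n+1},\dots)}|P(A\cap B)-P(A)P(B)|$. Assumption E: $\{\varepsilon_n\}$ is zero-mean strictly stationary $\alpha$-mixing, $\operatorname{Var}\varepsilon_n=1$, $E|\varepsilon_n|^p<\infty$ for some $p>2$, $\sum_n\alpha(n)^{2(1/r-1/p)}<\infty$ for some $r\in(2,4]$, $r\le p$, $\sum_n n\alpha(n)<\infty$, and $0<1+2\sum_{n\ge1}E\varepsilon_1\varepsilon_{n+1}<\infty$.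 Assumption V: $\sigma:[0,1]\to\mathbb{R}^+$ has finitely many discontinuity points and satisfies a first-order Lipschitz condition except at discontinuity points. Assumption C: $|\delta_n|\sqrt n\to\infty$. Statistics: $V_n(k)=\sum_{i=1}^kY_{n,i}$, $\widetilde V_n(k)=V_n(n)-V_n(k)$, $\mathscr{Q}(V_n)=\max_{1\le k\le n}\left|\frac{V_n(k)-\frac knV_n(n)}{\max_{1\le i\le k}|V_n(i)-\frac ikV_n(k)|+\max_{k<i\le n}|\widetilde V_n(i)-\frac{n-i}{n-k}\widetilde V_n(k)|}\right|$, $\mathscr{R}(V_n)=\sum_{k=1}^n\frac{\{V_n(k)-\frac knV_n(n)\}^2}{\sum_{i=1}^k\{V_n(i)-\frac ikV_n(k)\}^2+\sum_{i=k+1}^n\{\widetilde V_n(i)-\frac{n-i}{n-k}\widetilde V_n(k)\}^2}$. *)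

theory Defs
  imports "HOL-Probability.Probability"
begin

text \<open>Processes are indexed from 0 here: X 0, X 1, ... stands for
  epsilon_1, epsilon_2, ... of the paper.\<close>

definition gen_sigma :: "'a measure \<Rightarrow> (nat \<Rightarrow> 'a \<Rightarrow> real) \<Rightarrow> nat set \<Rightarrow> 'a set set" where
  "gen_sigma M X I = sigma_sets (space M) (\<Union>i\<in>I. {X i -` B \<inter> space M | B. B \<in> sets borel})"

text \<open>Strong mixing coefficient alpha(n) (k ranges over k >= 1 in the paper's indexing,
  i.e. past = {X 0..X kk}, future = {X (kk+n), ...} with kk = k - 1).\<close>
definition alpha_mix :: "'a measure \<Rightarrow> (nat \<Rightarrow> 'a \<Rightarrow> real) \<Rightarrow> nat \<Rightarrow> real" where
  "alpha_mix M X n = (SUP kk. SUP AB \<in> gen_sigma M X {..kk} \<times> gen_sigma M X {kk+n..}.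
      \<bar>measure M (fst AB \<inter> snd AB) - measure M (fst AB) * measure M (snd AB)\<bar>)"

definition strictly_stationary :: "'a measure \<Rightarrow> (nat \<Rightarrow> 'a \<Rightarrow> real) \<Rightarrow> bool" where
  "strictly_stationary M X \<longleftrightarrow> (\<forall>h.
      distr M (PiM UNIV (\<lambda>_. borel)) (\<lambda>\<omega> i. X (i + h) \<omega>)
    = distr M (PiM UNIV (\<lambda>_. borel)) (\<lambda>\<omega> i. X i \<omega>))"

text \<open>x^e with the usual convention 0^0 = 1 (Isabelle's powr has 0 powr 0 = 0).\<close>
definition rpow :: "real \<Rightarrow> real \<Rightarrow> real" where
  "rpow x e = (if e = 0 then 1 else x powr e)"

text \<open>Assumption E for the process X (X i = epsilon_{i+1}).\<close>
definition assumption_E :: "'a measure \<Rightarrow> (nat \<Rightarrow> 'a \<Rightarrow> real) \<Rightarrow> bool" where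
  "assumption_E M X \<longleftrightarrow>
     (\<forall>i. X i \<in> borel_measurable M) \<and>
     strictly_stationary M X \<and>
     integrable M (X 0) \<and> prob_space.expectation M (X 0) = 0 \<and>
     integrable M (\<lambda>\<omega>. (X 0 \<omega>)\<^sup>2) \<and> prob_space.variance M (X 0) = 1 \<and>
     (\<exists>p r. p > 2 \<and> integrable M (\<lambda>\<omega>. \<bar>X 0 \<omega>\<bar> powr p) \<and>
            2 < r \<and> r \<le> 4 \<and> r \<le> p \<and>
            summable (\<lambda>n. rpow (alpha_mix M X (Suc n)) (2 * (1 / r - 1 / p)))) \<and>
     summable (\<lambda>n. real n * alpha_mix M X n) \<and>
     (\<forall>n. integrable M (\<lambda>\<omega>. X 0 \<omega> * X n \<omega>)) \<and>
     summable (\<lambda>m. prob_space.expectation M (\<lambda>\<omega>. X 0 \<omega> * X (Suc m) \<omega>)) \<and>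
     0 < 1 + 2 * (\<Sum>m. prob_space.expectation M (\<lambda>\<omega>. X 0 \<omega> * X (Suc m) \<omega>))"

definition assumption_V :: "(real \<Rightarrow> real) \<Rightarrow> bool" where
  "assumption_V \<sigma> \<longleftrightarrow>
     (\<forall>x\<in>{0..1}. 0 < \<sigma> x) \<and>
     finite {x\<in>{0..1}. \<not> continuous (at x within {0..1}) \<sigma>} \<and>
     (\<exists>D L. finite D \<and> (\<forall>x\<in>{0..1}. \<forall>y\<in>{0..1}.
        {min x y..max x y} \<inter> D = {} \<longrightarrow> \<bar>\<sigma> x - \<sigma> y\<bar> \<le> L * \<bar>x - y\<bar>))"

definition partial_sum :: "(nat \<Rightarrow> real) \<Rightarrow> nat \<Rightarrow> real" where
  "partial_sum y k = (\<Sum>i=1..k. y i)"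

text \<open>Statistic Q. Maxima over empty index sets are read as 0.\<close>
definition Q_stat :: "nat \<Rightarrow> (nat \<Rightarrow> real) \<Rightarrow> real" where
  "Q_stat n v = Max (insert 0 ((\<lambda>k.
      \<bar>(v k - real k / real n * v n) /
        (Max (insert 0 ((\<lambda>i. \<bar>v i - real i / real k * v k\<bar>) ` {1..k}))
       + Max (insert 0 ((\<lambda>i. \<bar>(v n - v i) - real (n - i) / real (n - k) * (v n - v k)\<bar>) ` {k<..n})))\<bar>)
     ` {1..n}))"

definition R_stat :: "nat \<Rightarrow> (nat \<Rightarrow> real) \<Rightarrow> real" where
  "R_stat n v = (\<Sum>k=1..n.
      (v k - real k / real n * v n)\<^sup>2 /
      ((\<Sum>i=1..k. (v i - real i / real k * v k)\<^sup>2)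
       + (\<Sum>i=k+1..n. ((v n - v i) - real (n - i) / real (n - k) * (v n - v k))\<^sup>2)))"

end

theory Submission
  imports Defs
begin

text \<open>For every split point \<open>k\<close> in a window \<open>[\<tau> - \<eta> n, \<tau>]\<close> the numerators of both statistics are at
  least of the order \<open>\<kappa> |\<delta>| n\<close> with \<open>\<kappa> = \<zeta> (1 - \<zeta>) / 2\<close>, while all deviations in the denominators
  are at most of the order \<open>\<eta> |\<delta>| n\<close>, provided that the partial sums of the noise stay below
  \<open>\<eta> |\<delta>| n\<close>. Hence \<open>Q\<close> and \<open>R\<close> are at least a constant times \<open>\<kappa> / \<eta>\<close> and \<open>\<kappa>\<^sup>2 / \<eta>\<close>, and \<open>\<eta>\<close> is
  arbitrary. Since \<open>|\<delta>| \<surd>n \<rightarrow> \<infinity>\<close>, the noise condition follows from the maximal inequality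
  \<open>P (max\<^sub>k |S\<^sub>k| > y) \<le> K n / y\<^sup>2\<close> for weighted sums of the mixing sequence.

  No lower bound for the noise is needed to exclude vanishing denominators (where Isabelle's division
  gives 0): two split points with zero denominator would make the partial sums linear and
  hence the numerators zero, so at most one point of the window is lost.\<close>

subsection \<open>Deterministic bounds on the statistics\<close>

text \<open>Vanishing left deviations for \<open>k'\<close> make \<open>v\<close> proportional to
  the index up to \<open>k'\<close>, with slope \<open>s\<close>; vanishing right deviations for
  \<open>k\<close> make \<open>v\<close> affine from \<open>k\<close> on, with slope
  \<open>t\<close>. The two stretches overlap between \<open>k\<close> and \<open>k'\<close>, so the
  slopes agree and \<open>v\<close> lies on one line through the origin.\<close>

lemma zero_denominators_imp_linear:
  fixes v :: "nat \<Rightarrow> real"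
  assumes k: "1 \<le> k" "k < k'" "k' < n"
    and l: "\<And>i. i \<in> {1..k'} \<Longrightarrow> v i - real i / real k' * v k' = 0"
    and r: "\<And>i. i \<in> {k<..n} \<Longrightarrow> (v n - v i) - real (n - i) / real (n - k) * (v n - v k) = 0"
  shows "v k - real k / real n * v n = 0"
proof -
  define s where "s = v k' / real k'"
  define t where "t = (v n - v k) / real (n - k)"
  have 1: "v k = real k * s" "v k' = real k' * s"
    using l[of k] k by (auto simp: s_def)
  have 2: "v n - v k' = real (n - k') * t"
    using r[of k'] k by (simp add: t_def)
  have 3: "v n - v k = real (n - k) * t"
    using k by (simp add: t_def)
  have "(real k' - real k) * t = (real k' - real k) * s"
    using 1 2 3 k by (simp add: algebra_simps of_nat_diff)
  then have "s = t" using k by simp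
  then have "v n = real n * s"
    using 1 3 k by (simp add: algebra_simps of_nat_diff)
  then show ?thesis using 1 k by simp
qed

text \<open>The set \<open>Z\<close> of points of \<open>W\<close> with zero denominator has at most
  one element, because two of them would contradict the nonzero numerators. For
  \<open>Q_stat\<close> a single remaining point suffices, its denominator being a sum of two maxima
  bounded by \<open>D\<close>; for \<open>R_stat\<close> every remaining point contributes at least
  \<open>L\<^sup>2 / (n * D\<^sup>2)\<close>, since its denominator has \<open>n\<close> squared
  deviations.\<close>

lemma Q_R_stat_lower_bound:
  fixes v :: "nat \<Rightarrow> real"
  assumes W: "W \<subseteq> {1..<n}" "2 \<le> card W" and pos: "0 < L" "0 < D"
    and num: "\<And>k. k \<in> W \<Longrightarrow> L \<le> \<bar>v k - real k / real n * v n\<bar>"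
    and left: "\<And>k i. k \<in> W \<Longrightarrow> i \<in> {1..k} \<Longrightarrow> \<bar>v i - real i / real k * v k\<bar> \<le> D"
    and right: "\<And>k i. k \<in> W \<Longrightarrow> i \<in> {k<..n} \<Longrightarrow>
        \<bar>(v n - v i) - real (n - i) / real (n - k) * (v n - v k)\<bar> \<le> D"
  shows "L / (2 * D) \<le> Q_stat n v" and "(real (card W) - 1) * L\<^sup>2 / (real n * D\<^sup>2) \<le> R_stat n v"
proof -
  define l where "l = (\<lambda>k i. v i - real i / real k * v k)"
  define r where "r = (\<lambda>k i. (v n - v i) - real (n - i) / real (n - k) * (v n - v k))"
  define Z where "Z = {k \<in> W. (\<forall>i\<in>{1..k}. l k i = 0) \<and> (\<forall>i\<in>{k<..n}. r k i = 0)}"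
  have finW: "finite W" using W(1) finite_subset by blast
  have "k = k'" if "k \<in> Z" "k' \<in> Z" for k k'
  proof (rule ccontr)
    have no: False if "k \<in> Z" "k' \<in> Z" "k < k'" for k k'
    proof -
      have "v k - real k / real n * v n = 0"
      proof (rule zero_denominators_imp_linear[of k k'])
        have "k \<in> W" "k' \<in> W" using that by (simp_all add: Z_def)
        then show "1 \<le> k" "k' < n" using W by auto
        show "v i - real i / real k' * v k' = 0" if "i \<in> {1..k'}" for i
          using \<open>k' \<in> Z\<close> that unfolding Z_def l_def by blast
        show "(v n - v i) - real (n - i) / real (n - k) * (v n - v k) = 0" if "i \<in> {k<..n}" for i
          using \<open>k \<in> Z\<close> that unfolding Z_def r_def by blast
      qed fact
      with num[of k] that pos show False by (simp add: Z_def)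
    qed
    assume "k \<noteq> k'" then show False using no that by (metis nat_neq_iff)
  qed
  then have cardZ: "card Z \<le> 1"
    by (metis One_nat_def card_le_Suc0_iff_eq card.infinite le0)
  have cardWZ: "real (card W) - 1 \<le> real (card (W - Z))"
  proof -
    have "card (W - Z) = card W - card Z"
      by (rule card_Diff_subset) (auto simp: Z_def finW)
    then show ?thesis using cardZ by linarith
  qed
  define den where "den = (\<lambda>k. Max (insert 0 ((\<lambda>i. \<bar>l k i\<bar>) ` {1..k})) + Max (insert 0 ((\<lambda>i. \<bar>r k i\<bar>) ` {k<..n})))"
  have "card (W - Z) \<noteq> 0" using cardWZ W by linarith
  then obtain k where k: "k \<in> W" "k \<notin> Z" by (metis Diff_iff card.empty equals0I)
  have ge: "Max (insert 0 ((\<lambda>i. \<bar>l k i\<bar>) ` {1..k})) \<ge> 0" "Max (insert 0 ((\<lambda>i. \<bar>r k i\<bar>) ` {k<..n})) \<ge> 0"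
    by (simp_all add: Max_ge)
  have den_le: "den k \<le> 2 * D"
  proof -
    have "Max (insert 0 ((\<lambda>i. \<bar>l k i\<bar>) ` {1..k})) \<le> D" "Max (insert 0 ((\<lambda>i. \<bar>r k i\<bar>) ` {k<..n})) \<le> D"
      using left[OF k(1)] right[OF k(1)] pos by (auto simp: l_def r_def)
    then show ?thesis unfolding den_def by linarith
  qed
  have den_pos: "0 < den k"
  proof -
    have "\<exists>i. (i \<in> {1..k} \<and> l k i \<noteq> 0) \<or> (i \<in> {k<..n} \<and> r k i \<noteq> 0)"
      using k by (auto simp: Z_def)
    then obtain i where "(i \<in> {1..k} \<and> l k i \<noteq> 0) \<or> (i \<in> {k<..n} \<and> r k i \<noteq> 0)" by blast
    then have "0 < Max (insert 0 ((\<lambda>i. \<bar>l k i\<bar>) ` {1..k})) \<or> 0 < Max (insert 0 ((\<lambda>i. \<bar>r k i\<bar>) ` {k<..n}))"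
      by (subst (1 2) Max_gr_iff) auto
    then show ?thesis using ge unfolding den_def by linarith
  qed
  have "L / (2 * D) \<le> \<bar>v k - real k / real n * v n\<bar> / den k"
    by (rule frac_le) (use num[OF k(1)] pos den_pos den_le in auto)
  also have "\<dots> = \<bar>(v k - real k / real n * v n) / den k\<bar>" using den_pos by simp
  also have "\<dots> \<le> Q_stat n v"
    unfolding Q_stat_def den_def l_def r_def
    by (rule Max_ge, simp, rule insertI2, rule image_eqI[OF refl]) (use k W in auto)
  finally show "L / (2 * D) \<le> Q_stat n v" .

  define sq where "sq = (\<lambda>k. (\<Sum>i=1..k. (l k i)\<^sup>2) + (\<Sum>i=k+1..n. (r k i)\<^sup>2))"
  have sq0: "0 \<le> sq k" for k by (auto simp: sq_def intro!: sum_nonneg add_nonneg_nonneg)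
  have summand_ge: "L\<^sup>2 / (real n * D\<^sup>2) \<le> (v k - real k / real n * v n)\<^sup>2 / sq k" if k: "k \<in> W - Z" for k
  proof (rule frac_le)
    show "L\<^sup>2 \<le> (v k - real k / real n * v n)\<^sup>2"
      using num[of k] k pos by (simp add: abs_le_square_iff[symmetric])
    show "sq k \<le> real n * D\<^sup>2"
    proof -
      have a: "(\<Sum>i=1..k. (l k i)\<^sup>2) \<le> real (card {1..k}) * D\<^sup>2"
        by (rule sum_bounded_above) (use left[of k] k pos in \<open>auto simp: l_def abs_le_square_iff[symmetric]\<close>)
      have b: "(\<Sum>i=k+1..n. (r k i)\<^sup>2) \<le> real (card {k+1..n}) * D\<^sup>2"
        by (rule sum_bounded_above) (use right[of k] k pos in \<open>auto simp: r_def abs_le_square_iff[symmetric]\<close>)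
      have "k \<le> n" using k W by auto
      then have "real n * D\<^sup>2 = real (card {1..k}) * D\<^sup>2 + real (card {k+1..n}) * D\<^sup>2"
        by (simp add: algebra_simps)
      then show ?thesis using a b unfolding sq_def by linarith
    qed
    show "0 < sq k"
    proof (rule ccontr)
      assume "\<not> 0 < sq k"
      moreover have "0 \<le> (\<Sum>i=1..k. (l k i)\<^sup>2)" "0 \<le> (\<Sum>i=k+1..n. (r k i)\<^sup>2)" by (auto intro: sum_nonneg)
      ultimately have "(\<Sum>i=1..k. (l k i)\<^sup>2) = 0" "(\<Sum>i=k+1..n. (r k i)\<^sup>2) = 0"
        by (auto simp: sq_def)
      then have "k \<in> Z" using k by (auto simp: Z_def sum_nonneg_eq_0_iff)
      then show False using k by simp
    qed
  qed auto
  have "(real (card W) - 1) * L\<^sup>2 / (real n * D\<^sup>2) = (real (card W) - 1) * (L\<^sup>2 / (real n * D\<^sup>2))" by simp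
  also have "\<dots> \<le> real (card (W - Z)) * (L\<^sup>2 / (real n * D\<^sup>2))"
    by (rule mult_right_mono[OF cardWZ]) simp
  also have "\<dots> \<le> (\<Sum>k\<in>W - Z. (v k - real k / real n * v n)\<^sup>2 / sq k)"
    by (rule sum_bounded_below) (rule summand_ge)
  \<comment> \<open>The points outside \<open>W - Z\<close> can be added because their terms are
    nonnegative, the terms with zero denominator being 0 by convention.\<close>
  also have "\<dots> \<le> (\<Sum>k=1..n. (v k - real k / real n * v n)\<^sup>2 / sq k)"
    by (rule sum_mono2) (use W sq0 in auto)
  also have "\<dots> = R_stat n v" by (simp add: R_stat_def sq_def l_def r_def)
  finally show "(real (card W) - 1) * L\<^sup>2 / (real n * D\<^sup>2) \<le> R_stat n v" .
qed

section \<open>A change in mean plus bounded noise\<close>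

lemma abs_diff_scaled_le:
  fixes a b r :: real
  assumes "0 \<le> r" "r \<le> 1" "\<bar>a\<bar> \<le> y" "\<bar>b\<bar> \<le> z"
  shows "\<bar>a - r * b\<bar> \<le> y + z"
proof -
  have "\<bar>r * b\<bar> \<le> \<bar>b\<bar>"
    using mult_right_mono[of r 1 "\<bar>b\<bar>"] assms by (simp add: abs_mult)
  then show ?thesis using assms by linarith
qed

text \<open>Up to \<open>k \<le> \<tau>\<close> there is no change, so the linear trend cancels and
  only the noise remains. The truncated subtraction in \<open>real (j - \<tau>)\<close> counts the
  observations after the change among the first \<open>j\<close>.\<close>

lemma left_deviation_bound:
  fixes T v :: "nat \<Rightarrow> real"
  assumes v: "\<And>j. v j = real j * \<mu> + \<delta> * real (j - \<tau>) + T j"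
    and y: "\<And>j. j \<le> \<tau> \<Longrightarrow> \<bar>T j\<bar> \<le> y" and k: "1 \<le> i" "i \<le> k" "k \<le> \<tau>"
  shows "\<bar>v i - real i / real k * v k\<bar> \<le> 2 * y"
proof -
  have "v i - real i / real k * v k = T i - real i / real k * T k"
    using k by (simp add: v field_simps)
  moreover have "\<bar>T i - real i / real k * T k\<bar> \<le> y + y"
    by (rule abs_diff_scaled_le) (use k y in auto)
  ultimately show ?thesis by simp
qed

text \<open>Here the change lies between \<open>k\<close> and \<open>n\<close>, so besides the noise
  there is a bias. The ramp \<open>j - \<tau>\<close> differs from its linear interpolation on
  \<open>{k..n}\<close> by at most the distance from \<open>k\<close> to \<open>\<tau>\<close>,
  which stays small when \<open>k\<close> is close to the change point.\<close>

lemma right_deviation_bound: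
  fixes T v :: "nat \<Rightarrow> real"
  assumes v: "\<And>j. v j = real j * \<mu> + \<delta> * real (j - \<tau>) + T j"
    and y: "\<And>j. j \<le> n \<Longrightarrow> \<bar>T j\<bar> \<le> y" and k: "k \<le> \<tau>" "\<tau> < n" "k < i" "i \<le> n"
  shows "\<bar>(v n - v i) - real (n - i) / real (n - k) * (v n - v k)\<bar> \<le> 4 * y + \<bar>\<delta>\<bar> * real (\<tau> - k)"
proof -
  define \<rho> where "\<rho> = real (n - i) / real (n - k)"
  have \<rho>: "0 \<le> \<rho>" "\<rho> \<le> 1" using k by (auto simp: \<rho>_def)
  have \<rho>eq: "\<rho> * (real n - real k) = real n - real i"
    using k by (simp add: \<rho>_def of_nat_diff)
  define s where "s = real (n - \<tau>) - real (i - \<tau>) - \<rho> * real (n - \<tau>)"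
  have eq: "(v n - v i) - \<rho> * (v n - v k) = \<delta> * s + ((T n - T i) - \<rho> * (T n - T k))"
  proof -
    have "(v n - v i) - \<rho> * (v n - v k) = ((real n - real i) - \<rho> * (real n - real k)) * \<mu>
        + \<delta> * s + ((T n - T i) - \<rho> * (T n - T k))"
      using k by (simp add: v s_def algebra_simps)
    then show ?thesis by (simp add: \<rho>eq)
  qed
  \<comment> \<open>The bias factor \<open>s\<close> is largest at the kink
    \<open>i = \<tau>\<close>: before it, \<open>s\<close> is at most \<open>i - k\<close>; after
    it, \<open>s\<close> equals \<open>\<rho> * (\<tau> - k)\<close> with
    \<open>\<rho> \<le> 1\<close>.\<close>
  have s: "\<bar>s\<bar> \<le> real (\<tau> - k)"
  proof (cases "i \<le> \<tau>")
    case True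
    have "s = (1 - \<rho>) * (real n - real \<tau>)" using True k by (simp add: s_def algebra_simps of_nat_diff)
    moreover have "(1 - \<rho>) * (real n - real \<tau>) \<le> (1 - \<rho>) * (real n - real k)"
      by (rule mult_left_mono) (use \<rho> k in auto)
    moreover have "(1 - \<rho>) * (real n - real k) = real i - real k"
      using \<rho>eq by (simp add: algebra_simps)
    moreover have "0 \<le> (1 - \<rho>) * (real n - real \<tau>)" using \<rho> k by simp
    ultimately show ?thesis using True k by (simp add: of_nat_diff)
  next
    case False
    then have "s = (real n - real i) - \<rho> * (real n - real \<tau>)"
      using k by (simp add: s_def algebra_simps of_nat_diff)
    also have "\<dots> = \<rho> * (real \<tau> - real k)" using \<rho>eq by (simp add: algebra_simps)
    finally have "s = \<rho> * (real \<tau> - real k)" .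
    moreover have "\<rho> * (real \<tau> - real k) \<le> 1 * (real \<tau> - real k)"
      by (rule mult_right_mono) (use \<rho> k in auto)
    ultimately show ?thesis using \<rho> k by (simp add: of_nat_diff)
  qed
  have T: "\<bar>T n\<bar> \<le> y" "\<bar>T i\<bar> \<le> y" "\<bar>T k\<bar> \<le> y" using y k by auto
  have "\<bar>(T n - T i) - \<rho> * (T n - T k)\<bar> \<le> 2 * y + 2 * y"
    by (rule abs_diff_scaled_le) (use \<rho> T in linarith)+
  moreover have "\<bar>\<delta> * s\<bar> \<le> \<bar>\<delta>\<bar> * real (\<tau> - k)"
    using s by (simp add: abs_mult mult_left_mono)
  ultimately have "\<bar>(v n - v i) - \<rho> * (v n - v k)\<bar> \<le> 4 * y + \<bar>\<delta>\<bar> * real (\<tau> - k)"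
    unfolding eq by linarith
  then show ?thesis unfolding \<rho>_def .
qed

text \<open>For \<open>k \<le> \<tau>\<close> the ramp vanishes at \<open>k\<close>, while its
  linear interpolation between 0 and \<open>n\<close> has the value
  \<open>k * (n - \<tau>) / n\<close> there. The noise can change the difference by at most
  \<open>2 * y\<close>.\<close>

lemma numerator_bound:
  fixes T v :: "nat \<Rightarrow> real"
  assumes v: "\<And>j. v j = real j * \<mu> + \<delta> * real (j - \<tau>) + T j"
    and y: "\<And>j. j \<le> n \<Longrightarrow> \<bar>T j\<bar> \<le> y" and k: "k \<le> \<tau>" "\<tau> < n"
  shows "\<bar>\<delta>\<bar> * (real k * real (n - \<tau>) / real n) - 2 * y \<le> \<bar>v k - real k / real n * v n\<bar>"
proof -
  have eq: "v k - real k / real n * v n = - (\<delta> * (real k * real (n - \<tau>) / real n)) + (T k - real k / real n * T n)"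
    using k by (simp add: v field_simps)
  define b where "b = T k - real k / real n * T n"
  have "\<bar>b\<bar> \<le> y + y"
    unfolding b_def by (rule abs_diff_scaled_le) (use k y in auto)
  moreover define a where "a = real k * real (n - \<tau>) / real n"
  then have "\<bar>\<delta> * a\<bar> = \<bar>\<delta>\<bar> * a"
    by (simp add: abs_mult)
  ultimately show ?thesis unfolding eq a_def[symmetric] b_def[symmetric] by linarith
qed

text \<open>The window is formed by the \<open>m + 1\<close> points ending at \<open>\<tau>\<close>.
  On it the previous bounds hold with \<open>L = \<kappa> * d / 2\<close> and
  \<open>D = 5 * \<eta> * d\<close>, where \<open>d = \<bar>\<delta>\<bar> * n\<close>, and
  \<open>L / (2 * D)\<close> is the bound for \<open>Q_stat\<close>. For \<open>R_stat\<close> the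
  \<open>m\<close> surviving points number at least \<open>\<eta> * n / 2\<close>, which cancels one
  of the two factors \<open>\<eta>\<close> in the denominator.\<close>

lemma Q_R_stat_change_point_bound:
  fixes T v :: "nat \<Rightarrow> real"
  assumes v: "\<And>j. v j = real j * \<mu> + \<delta> * real (j - \<tau>) + T j"
    and T: "\<And>j. j \<le> n \<Longrightarrow> \<bar>T j\<bar> \<le> \<eta> * \<bar>\<delta>\<bar> * real n"
    and \<tau>: "m < \<tau>" "\<tau> < n" and \<kappa>: "\<kappa> * real n \<le> real (\<tau> - m) * real (n - \<tau>) / real n"
    and m: "1 \<le> m" "real m \<le> \<eta> * real n" "\<eta> * real n \<le> 2 * real m"
    and \<eta>: "0 < \<eta>" "4 * \<eta> \<le> \<kappa>" and \<delta>: "\<delta> \<noteq> 0"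
  shows "\<kappa> / (20 * \<eta>) \<le> Q_stat n v" and "\<kappa>\<^sup>2 / (200 * \<eta>) \<le> R_stat n v"
proof -
  define y where "y = \<eta> * \<bar>\<delta>\<bar> * real n"
  define d where "d = \<bar>\<delta>\<bar> * real n"
  define W where "W = {\<tau> - m..\<tau>}"
  have d: "0 < d" "y = \<eta> * d" using \<delta> \<tau> by (auto simp: d_def y_def)
  have n: "0 < real n" using \<tau> by simp
  have Wn: "W \<subseteq> {1..<n}" "card W = m + 1" using \<tau> by (auto simp: W_def)
  have num: "\<kappa> * d / 2 \<le> \<bar>v k - real k / real n * v n\<bar>" if k: "k \<in> W" for k
  proof -
    have "\<kappa> * real n \<le> real k * real (n - \<tau>) / real n"
      by (rule order_trans[OF \<kappa>]) (intro divide_right_mono mult_right_mono; use k in \<open>simp add: W_def\<close>)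
    then have "\<bar>\<delta>\<bar> * (\<kappa> * real n) \<le> \<bar>\<delta>\<bar> * (real k * real (n - \<tau>) / real n)" by (rule mult_left_mono) simp
    moreover have "\<bar>\<delta>\<bar> * (real k * real (n - \<tau>) / real n) - 2 * y \<le> \<bar>v k - real k / real n * v n\<bar>"
      by (rule numerator_bound[OF v]) (use T k \<tau> in \<open>auto simp: y_def W_def\<close>)
    moreover have "\<bar>\<delta>\<bar> * (\<kappa> * real n) = \<kappa> * d" by (simp add: d_def)
    \<comment> \<open>The noise term \<open>2 * y\<close> uses up at most half of the signal
      \<open>\<kappa> * d\<close>.\<close>
    moreover have "4 * \<eta> * d \<le> \<kappa> * d" by (rule mult_right_mono) (use \<eta> d in auto)
    ultimately show ?thesis unfolding d(2) by linarith
  qed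
  have y0: "0 \<le> y" using d \<eta> by simp
  have left: "\<bar>v i - real i / real k * v k\<bar> \<le> 5 * y" if "k \<in> W" "i \<in> {1..k}" for k i
  proof -
    have "\<bar>v i - real i / real k * v k\<bar> \<le> 2 * y"
      by (rule left_deviation_bound[OF v]) (use T that \<tau> in \<open>auto simp: y_def W_def\<close>)
    also have "\<dots> \<le> 5 * y" using y0 by simp
    finally show ?thesis .
  qed
  \<comment> \<open>The constant 5 combines \<open>4 * y\<close> from the noise with one further
    \<open>y\<close> that bounds the bias across the window.\<close>
  have right: "\<bar>(v n - v i) - real (n - i) / real (n - k) * (v n - v k)\<bar> \<le> 5 * y"
    if k: "k \<in> W" "i \<in> {k<..n}" for k i
  proof -
    have "\<bar>(v n - v i) - real (n - i) / real (n - k) * (v n - v k)\<bar> \<le> 4 * y + \<bar>\<delta>\<bar> * real (\<tau> - k)"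
      by (rule right_deviation_bound[OF v]) (use T k \<tau> in \<open>auto simp: y_def W_def\<close>)
    moreover have "real (\<tau> - k) \<le> \<eta> * real n"
      by (rule order_trans[OF _ m(2)]) (use k in \<open>auto simp: W_def\<close>)
    then have "\<bar>\<delta>\<bar> * real (\<tau> - k) \<le> \<bar>\<delta>\<bar> * (\<eta> * real n)" by (rule mult_left_mono) simp
    moreover have "\<bar>\<delta>\<bar> * (\<eta> * real n) = y" by (simp add: y_def)
    ultimately show ?thesis by linarith
  qed
  have pos: "0 < \<kappa> * d / 2" "0 < 5 * y" using d \<eta> by auto
  have card: "2 \<le> card W" using Wn m by simp
  note bounds = Q_R_stat_lower_bound[OF Wn(1) card pos num left right]
  have "\<kappa> / (20 * \<eta>) = \<kappa> * d / 2 / (2 * (5 * y))" using d \<eta> by (simp add: field_simps)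
  also have "\<dots> \<le> Q_stat n v" by (rule bounds(1))
  finally show "\<kappa> / (20 * \<eta>) \<le> Q_stat n v" .
  have "\<kappa>\<^sup>2 / (200 * \<eta>) = \<kappa>\<^sup>2 / (100 * \<eta>\<^sup>2 * real n) * (\<eta> * real n / 2)"
    using \<eta> n by (simp add: field_simps power2_eq_square)
  also have "\<dots> \<le> \<kappa>\<^sup>2 / (100 * \<eta>\<^sup>2 * real n) * real m"
    by (rule mult_left_mono) (use m in auto)
  also have "\<dots> = (real (card W) - 1) * (\<kappa> * d / 2)\<^sup>2 / (real n * (5 * y)\<^sup>2)"
    using d \<eta> n Wn by (simp add: field_simps power2_eq_square)
  also have "\<dots> \<le> R_stat n v" by (rule bounds(2))
  finally show "\<kappa>\<^sup>2 / (200 * \<eta>) \<le> R_stat n v" .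
qed

section \<open>Boundedness of the scale function\<close>

text \<open>The finite exceptional set cuts the unit interval into finitely many pieces. On each
  piece the Lipschitz condition applies to any two points and bounds \<sigma>; the values on the
  exceptional set itself are finitely many.\<close>

lemma assumption_V_bounded:
  assumes "assumption_V \<sigma>"
  obtains B where "0 < B" "\<And>x. x \<in> {0..1} \<Longrightarrow> \<bar>\<sigma> x\<bar> \<le> B"
proof -
  obtain D L where D: "finite D" and L: "\<And>x y. x \<in> {0..1} \<Longrightarrow> y \<in> {0..1} \<Longrightarrow>
      {min x y..max x y} \<inter> D = {} \<Longrightarrow> \<bar>\<sigma> x - \<sigma> y\<bar> \<le> L * \<bar>x - y\<bar>"
    using assms unfolding assumption_V_def by blast
  \<comment> \<open>A piece is encoded by the set \<open>S\<close> of exceptional points to its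
    left: two points outside \<open>D\<close> with the same \<open>S\<close> have no point of
    \<open>D\<close> between them.\<close>
  define C where "C = (\<lambda>S. {x \<in> {0..1} - D. {d \<in> D. d < x} = S})"
  have "bounded (\<sigma> ` C S)" for S
  proof (cases "C S = {}")
    case False
    then obtain x0 where x0: "x0 \<in> C S" by blast
    have "\<bar>\<sigma> x\<bar> \<le> \<bar>\<sigma> x0\<bar> + \<bar>L\<bar>" if x: "x \<in> C S" for x
    proof -
      have x01: "x \<in> {0..1}" "x0 \<in> {0..1}" and notD: "x \<notin> D" "x0 \<notin> D"
        using x x0 unfolding C_def by blast+
      have "{min x x0..max x x0} \<inter> D = {}"
      proof (rule ccontr)
        assume "{min x x0..max x x0} \<inter> D \<noteq> {}"
        then obtain d where "d \<in> D" "min x x0 \<le> d" "d \<le> max x x0" by auto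
        moreover have "d \<noteq> x" "d \<noteq> x0" using \<open>d \<in> D\<close> notD by auto
        moreover have "d < x \<longleftrightarrow> d < x0" 
        proof -
          have "{d \<in> D. d < x} = S" "{d \<in> D. d < x0} = S" using x x0 unfolding C_def by blast+
          then have "{d \<in> D. d < x} = {d \<in> D. d < x0}" by (rule trans[OF _ sym])
          then show ?thesis using \<open>d \<in> D\<close> by blast
        qed
        ultimately show False by (cases "d < x") (auto simp: min_def max_def split: if_splits)
      qed
      then have "\<bar>\<sigma> x - \<sigma> x0\<bar> \<le> L * \<bar>x - x0\<bar>"
        by (intro L x01)
      also have "\<dots> \<le> \<bar>L\<bar> * 1"
        by (rule mult_mono) (use x01 in auto)
      finally show ?thesis by linarith
    qed
    then show ?thesis by (auto simp: bounded_iff)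
  qed auto
  then have "bounded (\<Union>S\<in>Pow D. \<sigma> ` C S)"
    by (intro bounded_UN) (use D in auto)
  moreover have "bounded (\<sigma> ` D)" using D by (simp add: finite_imp_bounded)
  ultimately have "bounded ((\<Union>S\<in>Pow D. \<sigma> ` C S) \<union> \<sigma> ` D)" by simp
  then obtain B where B: "\<And>z. z \<in> (\<Union>S\<in>Pow D. \<sigma> ` C S) \<union> \<sigma> ` D \<Longrightarrow> \<bar>z\<bar> \<le> B"
    by (metis bounded_iff real_norm_def)
  have "\<bar>\<sigma> x\<bar> \<le> max B 1" if "x \<in> {0..1}" for x
  proof -
    have "\<sigma> x \<in> (\<Union>S\<in>Pow D. \<sigma> ` C S) \<union> \<sigma> ` D"
    proof (cases "x \<in> D")
      case False
      then have "x \<in> C {d \<in> D. d < x}" using that by (auto simp: C_def)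
      then show ?thesis by (intro UnI1 UN_I[of "{d \<in> D. d < x}"]) auto
    qed auto
    from B[OF this] show ?thesis by simp
  qed
  then show ?thesis by (intro that[of "max B 1"]) auto
qed

section \<open>Measurability of the two statistics\<close>

lemma borel_measurable_Max_insert_0:
  fixes f :: "'i \<Rightarrow> 'a \<Rightarrow> real"
  assumes "finite I" "\<And>i. i \<in> I \<Longrightarrow> f i \<in> borel_measurable M"
  shows "(\<lambda>x. Max (insert 0 ((\<lambda>i. f i x) ` I))) \<in> borel_measurable M"
proof (cases "I = {}")
  case False
  then have "(\<lambda>x. Max (insert 0 ((\<lambda>i. f i x) ` I))) = (\<lambda>x. max 0 (Max ((\<lambda>i. f i x) ` I)))"
    using assms by simp
  moreover have "(\<lambda>x. max 0 (Max ((\<lambda>i. f i x) ` I))) \<in> borel_measurable M"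
    by (intro borel_measurable_max borel_measurable_const borel_measurable_Max assms)
  ultimately show ?thesis by simp
qed simp

lemma borel_measurable_Q_stat:
  assumes "\<And>k. (\<lambda>x. v x k) \<in> borel_measurable M"
  shows "(\<lambda>x. Q_stat n (v x)) \<in> borel_measurable M"
  unfolding Q_stat_def
  by (intro borel_measurable_Max_insert_0 finite_atLeastAtMost finite_greaterThanAtMost borel_measurable_abs
      borel_measurable_divide borel_measurable_add borel_measurable_diff borel_measurable_times
      borel_measurable_const assms)

lemma borel_measurable_R_stat:
  assumes "\<And>k. (\<lambda>x. v x k) \<in> borel_measurable M"
  shows "(\<lambda>x. R_stat n (v x)) \<in> borel_measurable M"
  unfolding R_stat_def
  by (intro borel_measurable_sum borel_measurable_power borel_measurable_divide borel_measurable_add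
      borel_measurable_diff borel_measurable_times borel_measurable_const assms)

subsection \<open>Covariance inequalities under strong mixing\<close>

text \<open>This packages \<open>gen_sigma\<close> as a measure space, so that the rules for
  measurable functions can place events of the process in the past or the future.\<close>

definition gen_algebra :: "'a measure \<Rightarrow> (nat \<Rightarrow> 'a \<Rightarrow> real) \<Rightarrow> nat set \<Rightarrow> 'a measure" where
  "gen_algebra M X I = sigma (space M) (\<Union>i\<in>I. {X i -` B \<inter> space M | B. B \<in> sets borel})"

lemma space_gen_algebra [simp]: "space (gen_algebra M X I) = space M"
  unfolding gen_algebra_def by (rule space_measure_of) auto

lemma sets_gen_algebra: "sets (gen_algebra M X I) = gen_sigma M X I"
  unfolding gen_algebra_def gen_sigma_def by (rule sets_measure_of) auto

lemma measurable_gen_algebra: "i \<in> I \<Longrightarrow> X i \<in> borel_measurable (gen_algebra M X I)"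
  by (rule measurableI) (auto simp: sets_gen_algebra gen_sigma_def intro!: sigma_sets.Basic)

lemma gen_sigma_mono: "I \<subseteq> J \<Longrightarrow> gen_sigma M X I \<subseteq> gen_sigma M X J"
  unfolding gen_sigma_def by (rule sigma_sets_mono') blast

lemma empty_in_gen_sigma: "{} \<in> gen_sigma M X I"
  unfolding gen_sigma_def by (rule sigma_sets.Empty)

lemma abs_mult_diff_le:
  fixes a b c d :: real
  assumes "\<bar>a - c\<bar> \<le> r" "\<bar>b - d\<bar> \<le> s" "\<bar>b\<bar> \<le> t" "\<bar>c\<bar> \<le> u"
  shows "\<bar>a * b - c * d\<bar> \<le> r * t + u * s"
proof -
  have "a * b - c * d = (a - c) * b + c * (b - d)" by (simp add: algebra_simps)
  then have "\<bar>a * b - c * d\<bar> \<le> \<bar>a - c\<bar> * \<bar>b\<bar> + \<bar>c\<bar> * \<bar>b - d\<bar>"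
    by (metis abs_mult abs_triangle_ineq)
  also have "\<dots> \<le> r * t + u * s"
    by (intro add_mono mult_mono) (use assms in auto)
  finally show ?thesis .
qed

text \<open>On the unit interval this rounds \<open>u\<close> down to a multiple of
  \<open>1 / m\<close>. It is written as an average of indicators of level sets, so that
  expectations, also of products, become averages of probabilities.\<close>

definition grid_floor :: "nat \<Rightarrow> real \<Rightarrow> real" where
  "grid_floor m u = (\<Sum>j=1..m. indicat_real {real j / real m..} u) / real m"

lemma grid_floor_bounds:
  assumes "0 < m" "0 \<le> u" "u \<le> 1"
  shows "\<bar>u - grid_floor m u\<bar> \<le> 1 / real m" "\<bar>grid_floor m u\<bar> \<le> 1"
proof -
  define N where "N = nat \<lfloor>u * real m\<rfloor>"
  have "u * real m \<le> 1 * real m" by (rule mult_right_mono) (use assms in auto)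
  moreover have "real N = of_int \<lfloor>u * real m\<rfloor>" using assms by (simp add: N_def)
  ultimately have N: "real N \<le> u * real m" "u * real m < real N + 1" "N \<le> m" by linarith+
  have "real j / real m \<le> u \<longleftrightarrow> j \<le> N" for j
  proof -
    have "real j / real m \<le> u \<longleftrightarrow> real j \<le> u * real m" using assms by (simp add: divide_le_eq)
    also have "\<dots> \<longleftrightarrow> j \<le> N" using N by linarith
    finally show ?thesis .
  qed
  then have "(\<Sum>j=1..m. indicat_real {real j / real m..} u) = (\<Sum>j=1..m. if j \<in> {1..N} then 1 else 0)"
    by (intro sum.cong) (auto simp: indicator_def)
  also have "\<dots> = (\<Sum>j\<in>{1..m} \<inter> {1..N}. 1)" by (rule sum.inter_restrict[symmetric]) simp
  also have "{1..m} \<inter> {1..N} = {1..N}" using N by auto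
  finally have eq: "grid_floor m u = real N / real m" by (simp add: grid_floor_def)
  show "\<bar>grid_floor m u\<bar> \<le> 1" using eq N assms by simp
  have "\<bar>u - grid_floor m u\<bar> = \<bar>u * real m - real N\<bar> / real m" using assms by (simp add: eq field_simps)
  also have "\<dots> \<le> 1 / real m" by (rule divide_right_mono) (use N in auto)
  finally show "\<bar>u - grid_floor m u\<bar> \<le> 1 / real m" .
qed

lemma grid_floor_measurable [measurable]: "grid_floor m \<in> borel_measurable borel"
  unfolding grid_floor_def by measurable

section \<open>Mixing coefficients and covariances of bounded variables\<close>

context prob_space
begin

lemma abs_prob_diff_le_1: "\<bar>prob (A \<inter> B) - prob A * prob B\<bar> \<le> 1"
proof -
  have "prob A * prob B \<le> 1" by (rule mult_le_one) auto
  moreover have "0 \<le> prob A * prob B" "0 \<le> prob (A \<inter> B)" "prob (A \<inter> B) \<le> 1" by simp_all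
  ultimately show ?thesis by linarith
qed

text \<open>Both nested suprema are over real numbers, so each use requires a bound and a nonempty
  index set. The bound is 1, and the pair of empty sets always belongs to the index set.\<close>

lemma alpha_mix_bounds:
  shows "0 \<le> alpha_mix M X n" "alpha_mix M X n \<le> 1"
    and alpha_mix_ge: "A \<in> gen_sigma M X {..k} \<Longrightarrow> B \<in> gen_sigma M X {k+n..} \<Longrightarrow>
      \<bar>prob (A \<inter> B) - prob A * prob B\<bar> \<le> alpha_mix M X n"
proof -
  define f where "f = (\<lambda>AB. \<bar>prob (fst AB \<inter> snd AB) - prob (fst AB) * prob (snd AB)\<bar>)"
  define G where "G = (\<lambda>k. gen_sigma M X {..k} \<times> gen_sigma M X {k+n..})"
  have alpha: "alpha_mix M X n = (SUP k. SUP AB \<in> G k. f AB)"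
    by (simp add: alpha_mix_def f_def G_def)
  have f1: "f AB \<le> 1" for AB by (simp add: f_def abs_prob_diff_le_1)
  have ne: "({}, {}) \<in> G k" for k by (simp add: G_def empty_in_gen_sigma)
  have bdd: "bdd_above (f ` S)" for S by (rule bdd_aboveI2[OF f1])
  have S1: "(SUP AB \<in> G k. f AB) \<le> 1" for k
    by (rule cSUP_least) (use ne f1 in auto)
  show "alpha_mix M X n \<le> 1" unfolding alpha by (rule cSUP_least) (use S1 in auto)
  have ge: "f AB \<le> alpha_mix M X n" if "AB \<in> G k" for AB k
  proof -
    have "f AB \<le> (SUP AB \<in> G k. f AB)" by (rule cSUP_upper[OF that bdd])
    also have "\<dots> \<le> alpha_mix M X n"
      unfolding alpha by (rule cSUP_upper[OF UNIV_I bdd_aboveI2[OF S1]])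
    finally show ?thesis .
  qed
  show "0 \<le> alpha_mix M X n" using ge[OF ne] by (simp add: f_def)
  show "\<bar>prob (A \<inter> B) - prob A * prob B\<bar> \<le> alpha_mix M X n"
    if "A \<in> gen_sigma M X {..k}" "B \<in> gen_sigma M X {k+n..}"
    using ge[of "(A, B)" k] that by (simp add: f_def G_def)
qed

text \<open>A larger gap shrinks the future sigma-algebra, hence the set over which the supremum is
  taken.\<close>

lemma alpha_mix_antimono:
  assumes "m \<le> n"
  shows "alpha_mix M X n \<le> alpha_mix M X m"
proof -
  have "\<bar>prob (fst AB \<inter> snd AB) - prob (fst AB) * prob (snd AB)\<bar> \<le> alpha_mix M X m"
    if "AB \<in> gen_sigma M X {..k} \<times> gen_sigma M X {k+n..}" for AB k
    by (rule alpha_mix_ge[of _ _ k])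
      (use that gen_sigma_mono[of "{k+n..}" "{k+m..}" M X] assms in auto)
  then show ?thesis
    unfolding alpha_mix_def[of M X n]
    by (intro cSUP_least) (use empty_in_gen_sigma in blast)+
qed

text \<open>By monotonicity \<open>\<alpha>(q)\<close> can be replaced by \<open>\<alpha>(j)\<close>
  for every \<open>j \<le> q\<close>, and the integers up to \<open>q\<close> sum to at least half
  of \<open>q\<close> squared. Summability thus becomes the pointwise rate
  \<open>1 / q\<^sup>2\<close>.\<close>

lemma alpha_mix_square_le:
  assumes "summable (\<lambda>n. real n * alpha_mix M X n)"
  shows "(real q)\<^sup>2 * alpha_mix M X q \<le> 2 * (\<Sum>n. real n * alpha_mix M X n)"
proof -
  have "(real q)\<^sup>2 \<le> 2 * (\<Sum>j=0..q. real j)"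
    by (simp add: double_gauss_sum power2_eq_square algebra_simps)
  then have "(real q)\<^sup>2 * alpha_mix M X q \<le> 2 * (\<Sum>j=0..q. real j) * alpha_mix M X q"
    by (rule mult_right_mono) (rule alpha_mix_bounds)
  also have "\<dots> = 2 * (\<Sum>j=0..q. real j * alpha_mix M X q)"
    by (simp add: sum_distrib_right)
  also have "\<dots> \<le> 2 * (\<Sum>j=0..q. real j * alpha_mix M X j)"
    by (intro mult_left_mono sum_mono alpha_mix_antimono) auto
  also have "\<dots> \<le> 2 * (\<Sum>n. real n * alpha_mix M X n)"
    by (intro mult_left_mono sum_le_suminf assms) (auto simp: alpha_mix_bounds)
  finally show ?thesis .
qed

text \<open>This is a bound on the strong mixing coefficient between the sigma-algebras of two
  single variables. It passes to measurable functions of them, such as affine maps, truncations and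
  absolute values.\<close>

definition dependence_le :: "('a \<Rightarrow> real) \<Rightarrow> ('a \<Rightarrow> real) \<Rightarrow> real \<Rightarrow> bool" where
  "dependence_le U V a \<longleftrightarrow> (\<forall>A\<in>sets borel. \<forall>B\<in>sets borel.
    \<bar>prob ((U -` A \<inter> space M) \<inter> (V -` B \<inter> space M)) -
      prob (U -` A \<inter> space M) * prob (V -` B \<inter> space M)\<bar> \<le> a)"

lemma dependence_le_mono: "dependence_le U V a \<Longrightarrow> a \<le> b \<Longrightarrow> dependence_le U V b"
  unfolding dependence_le_def by (meson order_trans)

lemma dependence_le_compose:
  assumes "dependence_le U V a" "f \<in> borel_measurable borel" "g \<in> borel_measurable borel"
  shows "dependence_le (\<lambda>x. f (U x)) (\<lambda>x. g (V x)) a"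
  unfolding dependence_le_def
proof (intro ballI)
  fix A B :: "real set" assume AB: "A \<in> sets borel" "B \<in> sets borel"
  have "f -` A \<in> sets borel" "g -` B \<in> sets borel"
    using measurable_sets[OF assms(2) AB(1)] measurable_sets[OF assms(3) AB(2)] by simp_all
  moreover have "(\<lambda>x. f (U x)) -` A = U -` (f -` A)" "(\<lambda>x. g (V x)) -` B = V -` (g -` B)" by auto
  ultimately show "\<bar>prob (((\<lambda>x. f (U x)) -` A \<inter> space M) \<inter> ((\<lambda>x. g (V x)) -` B \<inter> space M)) -
      prob ((\<lambda>x. f (U x)) -` A \<inter> space M) * prob ((\<lambda>x. g (V x)) -` B \<inter> space M)\<bar> \<le> a"
    using assms(1) unfolding dependence_le_def by simp
qed

lemma dependence_le_alpha_mix: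
  assumes "i \<le> j"
  shows "dependence_le (X i) (X j) (alpha_mix M X (j - i))"
  unfolding dependence_le_def
proof (intro ballI alpha_mix_ge)
  fix A B :: "real set" assume AB: "A \<in> sets borel" "B \<in> sets borel"
  show "X i -` A \<inter> space M \<in> gen_sigma M X {..i}"
    using AB unfolding gen_sigma_def by (intro sigma_sets.Basic) blast
  show "X j -` B \<inter> space M \<in> gen_sigma M X {i + (j - i)..}"
    using AB assms unfolding gen_sigma_def by (intro sigma_sets.Basic UN_I[of j]) auto
qed

lemma abs_expectation_diff_le:
  fixes f g h :: "'a \<Rightarrow> real"
  assumes "integrable M f" "integrable M g" "integrable M h"
    and "\<And>x. x \<in> space M \<Longrightarrow> \<bar>f x - g x\<bar> \<le> h x"
  shows "\<bar>expectation f - expectation g\<bar> \<le> expectation h"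
proof -
  have "\<bar>expectation f - expectation g\<bar> = \<bar>expectation (\<lambda>x. f x - g x)\<bar>"
    using assms by simp
  also have "\<dots> \<le> expectation (\<lambda>x. \<bar>f x - g x\<bar>)" by (rule integral_abs_bound)
  also have "\<dots> \<le> expectation h" by (rule integral_mono) (use assms in auto)
  finally show ?thesis .
qed

text \<open>Expanding both averages of indicators leaves \<open>m * m\<close> covariances of events,
  each at most \<open>a\<close>, divided by \<open>m * m\<close>. The bound therefore does not
  depend on the grid.\<close>

lemma covariance_grid_floor_le:
  assumes [measurable]: "U \<in> borel_measurable M" "V \<in> borel_measurable M"
    and dep: "dependence_le U V a" and m: "0 < m"
  shows "\<bar>expectation (\<lambda>x. grid_floor m (U x) * grid_floor m (V x)) -
    expectation (\<lambda>x. grid_floor m (U x)) * expectation (\<lambda>x. grid_floor m (V x))\<bar> \<le> a"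
proof -
  define E where "E = (\<lambda>W j. W -` {real j / real m..} \<inter> space M)"
  have [measurable]: "E U j \<in> sets M" "E V j \<in> sets M" for j by (simp_all add: E_def)
  have [simp]: "integrable M (indicat_real (E U j \<inter> E V l))" for j l
    by (rule integrable_const_bound[of _ 1]) auto
  have st: "grid_floor m (W x) = (\<Sum>j=1..m. indicat_real (E W j) x) / real m" if "x \<in> space M" for W x
    using that by (simp add: grid_floor_def E_def indicator_def)
  have *: "expectation (\<lambda>x. grid_floor m (W x)) = (\<Sum>j=1..m. prob (E W j)) / real m"
    if [measurable]: "W \<in> borel_measurable M" for W
  proof -
    have [measurable]: "E W j \<in> sets M" for j by (simp add: E_def)
    have [simp]: "integrable M (indicat_real (E W j))" for j
      by (rule integrable_const_bound[of _ 1]) auto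
    have "expectation (\<lambda>x. grid_floor m (W x)) = expectation (\<lambda>x. (\<Sum>j=1..m. indicat_real (E W j) x) / real m)"
      by (rule Bochner_Integration.integral_cong) (simp_all only: st)
    also have "\<dots> = (\<Sum>j=1..m. prob (E W j)) / real m" by simp
    finally show ?thesis .
  qed
  have "expectation (\<lambda>x. grid_floor m (U x) * grid_floor m (V x)) =
      expectation (\<lambda>x. (\<Sum>j=1..m. \<Sum>l=1..m. indicat_real (E U j \<inter> E V l) x) / (real m * real m))"
    by (rule Bochner_Integration.integral_cong)
      (simp_all only: st sum_product indicator_inter_arith times_divide_times_eq)
  also have "\<dots> = (\<Sum>j=1..m. \<Sum>l=1..m. prob (E U j \<inter> E V l)) / (real m * real m)"
    by simp
  finally have "expectation (\<lambda>x. grid_floor m (U x) * grid_floor m (V x)) -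
    expectation (\<lambda>x. grid_floor m (U x)) * expectation (\<lambda>x. grid_floor m (V x)) =
    (\<Sum>j=1..m. \<Sum>l=1..m. prob (E U j \<inter> E V l) - prob (E U j) * prob (E V l)) / (real m * real m)"
    by (simp add: * sum_product sum_subtractf diff_divide_distrib)
  also have "\<bar>\<dots>\<bar> = \<bar>\<Sum>j=1..m. \<Sum>l=1..m. prob (E U j \<inter> E V l) - prob (E U j) * prob (E V l)\<bar> / (real m * real m)"
    by simp
  also have "\<dots> \<le> (\<Sum>j=1..m. \<Sum>l=1..m. a) / (real m * real m)"
    by (intro divide_right_mono order_trans[OF sum_abs] sum_mono)
      (use dep in \<open>auto simp: dependence_le_def E_def\<close>)
  also have "\<dots> = a" using m by simp
  finally show ?thesis .
qed

text \<open>Rounding both variables to the grid changes the expectation of the product and the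
  product of the expectations by at most \<open>2 / m\<close> each. The claim follows as
  \<open>m\<close> tends to infinity.\<close>

lemma covariance_unit_interval_le:
  assumes [measurable]: "U \<in> borel_measurable M" "V \<in> borel_measurable M"
    and dep: "dependence_le U V a"
    and U: "\<And>x. x \<in> space M \<Longrightarrow> 0 \<le> U x \<and> U x \<le> 1"
    and V: "\<And>x. x \<in> space M \<Longrightarrow> 0 \<le> V x \<and> V x \<le> 1"
  shows "\<bar>expectation (\<lambda>x. U x * V x) - expectation U * expectation V\<bar> \<le> a"
proof -
  have int: "integrable M f" if "f \<in> borel_measurable M" "\<And>x. x \<in> space M \<Longrightarrow> \<bar>f x\<bar> \<le> 1" for f :: "'a \<Rightarrow> real"
    by (rule integrable_const_bound[of _ 1]) (use that in auto)
  have m1: "\<bar>a * b\<bar> \<le> 1" if "\<bar>a\<bar> \<le> 1" "\<bar>b\<bar> \<le> 1" for a b :: real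
    using mult_mono[of "\<bar>a\<bar>" 1 "\<bar>b\<bar>" 1] that by (simp add: abs_mult)
  have bound: "\<bar>expectation (\<lambda>x. U x * V x) - expectation U * expectation V\<bar> \<le> a + 4 * (1 / real m)"
    if m: "0 < m" for m
  proof -
    have UV1: "\<bar>U x\<bar> \<le> 1" "\<bar>V x\<bar> \<le> 1" if "x \<in> space M" for x using U V that by fastforce+
    note st = grid_floor_bounds[OF m]
    have dU: "\<bar>U x - grid_floor m (U x)\<bar> \<le> 1 / real m" "\<bar>grid_floor m (U x)\<bar> \<le> 1" if "x \<in> space M" for x
      using st U that by blast+
    have dV: "\<bar>V x - grid_floor m (V x)\<bar> \<le> 1 / real m" "\<bar>grid_floor m (V x)\<bar> \<le> 1" if "x \<in> space M" for x
      using st V that by blast+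
    have iU: "integrable M U" and iV: "integrable M V" by (rule int; use UV1 in auto)+
    have iSU: "integrable M (\<lambda>x. grid_floor m (U x))" and iSV: "integrable M (\<lambda>x. grid_floor m (V x))"
      by (rule int; use dU dV in auto)+
    have iUV: "integrable M (\<lambda>x. U x * V x)" by (rule int) (use UV1 m1 in auto)
    have iSUV: "integrable M (\<lambda>x. grid_floor m (U x) * grid_floor m (V x))" by (rule int) (use dU dV m1 in auto)
    have c: "integrable M (\<lambda>_. r)" for r :: real by simp
    have 1: "\<bar>expectation (\<lambda>x. U x * V x) - expectation (\<lambda>x. grid_floor m (U x) * grid_floor m (V x))\<bar>
        \<le> expectation (\<lambda>_. 1 / real m * 1 + 1 * (1 / real m))"
      by (rule abs_expectation_diff_le[OF iUV iSUV c], rule abs_mult_diff_le) (use UV1 dU dV in auto)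
    have 2: "\<bar>expectation U * expectation V - expectation (\<lambda>x. grid_floor m (U x)) * expectation (\<lambda>x. grid_floor m (V x))\<bar>
        \<le> 1 / real m * 1 + 1 * (1 / real m)"
    proof (rule abs_mult_diff_le)
      have "\<bar>expectation U - expectation (\<lambda>x. grid_floor m (U x))\<bar> \<le> expectation (\<lambda>_. 1 / real m)"
        by (rule abs_expectation_diff_le[OF iU iSU c]) (rule dU)
      then show "\<bar>expectation U - expectation (\<lambda>x. grid_floor m (U x))\<bar> \<le> 1 / real m" by (simp add: prob_space)
      have "\<bar>expectation V - expectation (\<lambda>x. grid_floor m (V x))\<bar> \<le> expectation (\<lambda>_. 1 / real m)"
        by (rule abs_expectation_diff_le[OF iV iSV c]) (rule dV)
      then show "\<bar>expectation V - expectation (\<lambda>x. grid_floor m (V x))\<bar> \<le> 1 / real m" by (simp add: prob_space)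
      have "\<bar>expectation V - expectation (\<lambda>_. 0)\<bar> \<le> expectation (\<lambda>_. 1)"
        by (rule abs_expectation_diff_le[OF iV c c]) (use UV1 in simp)
      then show "\<bar>expectation V\<bar> \<le> 1" by (simp add: prob_space)
      have "\<bar>expectation (\<lambda>x. grid_floor m (U x)) - expectation (\<lambda>_. 0)\<bar> \<le> expectation (\<lambda>_. 1)"
        by (rule abs_expectation_diff_le[OF iSU c c]) (use dU in simp)
      then show "\<bar>expectation (\<lambda>x. grid_floor m (U x))\<bar> \<le> 1" by (simp add: prob_space)
    qed
    have 3: "expectation (\<lambda>_. 1 / real m * 1 + 1 * (1 / real m)) = 1 / real m * 1 + 1 * (1 / real m)"
      by (simp add: prob_space)
    define t where "t = 1 / real m"
    show ?thesis
      using 1[unfolded 3] 2 covariance_grid_floor_le[OF assms(1,2) dep m] unfolding t_def[symmetric] by linarith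
  qed
  have "(\<lambda>m. a + 4 * (1 / real m)) \<longlonglongrightarrow> a + 4 * 0"
    by (intro tendsto_intros lim_1_over_n)
  then have "(\<lambda>m. a + 4 * (1 / real m)) \<longlonglongrightarrow> a" by simp
  then show ?thesis
    by (rule LIMSEQ_le_const) (use bound in \<open>auto intro!: exI[of _ 1]\<close>)
qed

text \<open>The affine map \<open>h\<close> sends \<open>[-N, N]\<close> to the unit interval.
  Shifts leave covariances unchanged and the scaling by \<open>1 / (2 * N)\<close> in both variables
  yields the factor \<open>4 * N\<^sup>2\<close>.\<close>

lemma covariance_bounded_le:
  assumes [measurable]: "U \<in> borel_measurable M" "V \<in> borel_measurable M"
    and dep: "dependence_le U V a" and N: "0 < N"
    and U: "\<And>x. x \<in> space M \<Longrightarrow> \<bar>U x\<bar> \<le> N"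
    and V: "\<And>x. x \<in> space M \<Longrightarrow> \<bar>V x\<bar> \<le> N"
  shows "\<bar>expectation (\<lambda>x. U x * V x) - expectation U * expectation V\<bar> \<le> 4 * N\<^sup>2 * a"
proof -
  define h where "h = (\<lambda>u. (u + N) / (2 * N))"
  have [measurable]: "h \<in> borel_measurable borel" by (simp add: h_def)
  have h: "0 \<le> h u \<and> h u \<le> 1" if "\<bar>u\<bar> \<le> N" for u
    using that N by (auto simp: h_def)
  have iU: "integrable M U" and iV: "integrable M V"
    by (rule integrable_const_bound[of _ N]; use U V in auto)+
  have "\<bar>U x * V x\<bar> \<le> N * N" if "x \<in> space M" for x
    unfolding abs_mult by (rule mult_mono) (use that U V N in auto)
  then have iUV: "integrable M (\<lambda>x. U x * V x)"
    by (intro integrable_const_bound[of _ "N * N"]) auto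
  have "\<bar>expectation (\<lambda>x. h (U x) * h (V x)) - expectation (\<lambda>x. h (U x)) * expectation (\<lambda>x. h (V x))\<bar> \<le> a"
    by (rule covariance_unit_interval_le) (use h U V dependence_le_compose[OF dep] in auto)
  also have "expectation (\<lambda>x. h (U x) * h (V x)) = (expectation (\<lambda>x. U x * V x) + N * expectation U + N * expectation V + N * N) / (4 * N\<^sup>2)"
  proof -
    have "expectation (\<lambda>x. h (U x) * h (V x)) = expectation (\<lambda>x. (U x * V x + N * U x + N * V x + N * N) / (4 * N\<^sup>2))"
      using N by (intro Bochner_Integration.integral_cong) (auto simp: h_def field_simps power2_eq_square)
    then show ?thesis using iU iV iUV by (simp add: prob_space)
  qed
  also have "expectation (\<lambda>x. h (U x)) = (expectation U + N) / (2 * N)"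
    using iU by (simp add: h_def prob_space)
  also have "expectation (\<lambda>x. h (V x)) = (expectation V + N) / (2 * N)"
    using iV by (simp add: h_def prob_space)
  also have "(e + N * u + N * v + N * N) / (4 * N\<^sup>2) - (u + N) / (2 * N) * ((v + N) / (2 * N)) = (e - u * v) / (4 * N\<^sup>2)" for e u v
    using N by (simp add: field_simps power2_eq_square)
  finally have "\<bar>expectation (\<lambda>x. U x * V x) - expectation U * expectation V\<bar> / (4 * N\<^sup>2) \<le> a"
    by simp
  then show ?thesis using N by (simp add: divide_le_eq mult.commute)
qed

end

section \<open>Truncation and covariances under a moment condition\<close>

lemma abs_le_1_plus_powr: "\<bar>u\<bar> \<le> 1 + \<bar>u\<bar> powr p" if "1 \<le> p" for u :: real
proof (cases "\<bar>u\<bar> \<le> 1")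
  case False
  then have "\<bar>u\<bar> powr 1 \<le> \<bar>u\<bar> powr p" using that by (intro powr_mono) auto
  then show ?thesis using False by simp
qed (auto intro: order_trans)

definition truncated :: "real \<Rightarrow> real \<Rightarrow> real" where
  "truncated N u = max (- N) (min N u)"

lemma abs_truncated_le: "0 \<le> N \<Longrightarrow> \<bar>truncated N u\<bar> \<le> N" and abs_truncated_le_abs: "0 \<le> N \<Longrightarrow> \<bar>truncated N u\<bar> \<le> \<bar>u\<bar>"
  and truncated_id: "\<bar>u\<bar> \<le> N \<Longrightarrow> truncated N u = u" and abs_diff_truncated_le: "0 \<le> N \<Longrightarrow> \<bar>u - truncated N u\<bar> \<le> \<bar>u\<bar>"
  by (auto simp: truncated_def min_def max_def)

lemma powr_le_tail:
  fixes N w p q :: real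
  assumes "0 < N" "N < w" "q \<le> p"
  shows "w powr q \<le> N powr (q - p) * w powr p"
proof -
  have "w powr q = w powr (q - p) * w powr p" by (simp add: powr_add[symmetric])
  also have "\<dots> \<le> N powr (q - p) * w powr p"
    by (intro mult_right_mono powr_mono2') (use assms in auto)
  finally show ?thesis .
qed

lemma abs_diff_truncated_le_powr:
  assumes "0 < N" "1 \<le> p"
  shows "\<bar>u - truncated N u\<bar> \<le> N powr (1 - p) * \<bar>u\<bar> powr p"
proof (cases "\<bar>u\<bar> \<le> N")
  case False
  then have "\<bar>u\<bar> powr 1 \<le> N powr (1 - p) * \<bar>u\<bar> powr p"
    using assms by (intro powr_le_tail) auto
  then show ?thesis using abs_diff_truncated_le[of N u] False assms by simp
qed (simp add: truncated_id)

text \<open>If both values are at most \<open>N\<close> in absolute value, truncation changes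
  nothing. Otherwise the larger absolute value \<open>w\<close> exceeds \<open>N\<close>, both
  products are at most \<open>w\<^sup>2\<close>, and the tail estimate trades this for a
  \<open>p\<close>-th power.\<close>

lemma abs_mult_diff_truncated_le_powr:
  assumes "0 < N" "2 \<le> p"
  shows "\<bar>u * v - truncated N u * truncated N v\<bar> \<le> 2 * N powr (2 - p) * (\<bar>u\<bar> powr p + \<bar>v\<bar> powr p)"
proof (cases "\<bar>u\<bar> \<le> N \<and> \<bar>v\<bar> \<le> N")
  case False
  define w where "w = max \<bar>u\<bar> \<bar>v\<bar>"
  have w: "N < w" "\<bar>u\<bar> \<le> w" "\<bar>v\<bar> \<le> w" using False by (auto simp: w_def)
  have "\<bar>u * v\<bar> \<le> w * w" unfolding abs_mult by (rule mult_mono) (use w in auto)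
  moreover have "\<bar>truncated N u * truncated N v\<bar> \<le> w * w" unfolding abs_mult
    by (rule mult_mono) (use w assms abs_truncated_le_abs[of N u] abs_truncated_le_abs[of N v] in linarith)+
  moreover have "w * w = w powr 2" using w assms by (simp add: powr_numeral power2_eq_square)
  moreover have "w powr 2 \<le> N powr (2 - p) * w powr p"
    using assms w by (intro powr_le_tail) auto
  moreover have "N powr (2 - p) * w powr p \<le> N powr (2 - p) * (\<bar>u\<bar> powr p + \<bar>v\<bar> powr p)"
    by (intro mult_left_mono) (auto simp: w_def max_def)
  ultimately show ?thesis by linarith
qed (simp add: truncated_id)

context prob_space
begin

text \<open>This is a form of Davydov's covariance inequality. The truncated variables are covered
  by the bounded case, which costs \<open>4 * N\<^sup>2 * a\<close>; truncation costs
  \<open>4 * K\<close> times \<open>N powr (2 - p)\<close> in the mixed moment and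
  \<open>4 * K\<^sup>2\<close> times the same power in the product of means.\<close>

lemma covariance_powr_le:
  assumes [measurable]: "U \<in> borel_measurable M" "V \<in> borel_measurable M"
    and dep: "dependence_le U V a" and a: "0 < a" "a \<le> 1" and p: "2 \<le> p"
    and iU: "integrable M (\<lambda>x. \<bar>U x\<bar> powr p)" and iV: "integrable M (\<lambda>x. \<bar>V x\<bar> powr p)"
    and K: "expectation (\<lambda>x. \<bar>U x\<bar> powr p) \<le> K" "expectation (\<lambda>x. \<bar>V x\<bar> powr p) \<le> K" "1 \<le> K"
  shows "integrable M (\<lambda>x. U x * V x)"
    and "\<bar>expectation (\<lambda>x. U x * V x) - expectation U * expectation V\<bar> \<le> (4 + 4 * K + 4 * K\<^sup>2) * a powr (1 - 2 / p)"
proof -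
  text \<open>This truncation level balances the two errors \<open>N\<^sup>2 * a\<close> and \<open>N powr (2 - p)\<close>.\<close>
  define N where "N = a powr (- (1 / p))"
  have N0: "0 < N" using a by (simp add: N_def)
  have N1: "1 \<le> N"
    unfolding N_def using a p powr_mono2'[of "- (1/p)" a 1] by simp
  have Na: "N\<^sup>2 * a = a powr (1 - 2 / p)"
  proof -
    have "N\<^sup>2 = a powr (- (2 / p))"
      by (simp add: N_def power2_eq_square powr_add[symmetric])
    then have "N\<^sup>2 * a = a powr (- (2 / p)) * a powr 1" using a by simp
    also have "\<dots> = a powr (- (2 / p) + 1)" by (simp only: powr_add)
    finally show ?thesis by simp
  qed
  have "- (1 / p) * (2 - p) = 1 - 2 / p" using p by (simp add: field_simps)
  then have Np: "N powr (2 - p) = a powr (1 - 2 / p)"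
    by (simp only: N_def powr_powr)
  have [measurable]: "truncated N \<in> borel_measurable borel" unfolding truncated_def by measurable
  have int1: "integrable M (\<lambda>x. 1 + \<bar>U x\<bar> powr p)" "integrable M (\<lambda>x. 1 + \<bar>V x\<bar> powr p)"
    using iU iV by auto
  have intU: "integrable M U"
    by (rule Bochner_Integration.integrable_bound[OF int1(1)])
      (use abs_le_1_plus_powr[of p] p in \<open>auto simp: abs_of_nonneg\<close>)
  have intV: "integrable M V"
    by (rule Bochner_Integration.integrable_bound[OF int1(2)])
      (use abs_le_1_plus_powr[of p] p in \<open>auto simp: abs_of_nonneg\<close>)
  define cU where "cU = (\<lambda>x. truncated N (U x))"
  define cV where "cV = (\<lambda>x. truncated N (V x))"
  have [measurable]: "cU \<in> borel_measurable M" "cV \<in> borel_measurable M" by (simp_all add: cU_def cV_def)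
  have cN: "\<bar>cU x\<bar> \<le> N" "\<bar>cV x\<bar> \<le> N" for x using N0 by (simp_all add: cU_def cV_def abs_truncated_le)
  have intc: "integrable M cU" "integrable M cV"
    by (rule integrable_const_bound[of _ N]; use cN in auto)+
  have cNN: "\<bar>cU x * cV x\<bar> \<le> N * N" for x
    unfolding abs_mult by (rule mult_mono) (use cN N0 in auto)
  have intcc: "integrable M (\<lambda>x. cU x * cV x)"
    by (rule integrable_const_bound[of _ "N * N"]) (use cNN in auto)
  have tail: "integrable M (\<lambda>x. 2 * N powr (2 - p) * (\<bar>U x\<bar> powr p + \<bar>V x\<bar> powr p))"
    using iU iV by auto
  have tail_le: "\<bar>U x * V x - cU x * cV x\<bar> \<le> 2 * N powr (2 - p) * (\<bar>U x\<bar> powr p + \<bar>V x\<bar> powr p)" for x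
    unfolding cU_def cV_def using N0 p by (rule abs_mult_diff_truncated_le_powr)
  have "integrable M (\<lambda>x. U x * V x - cU x * cV x)"
    by (rule Bochner_Integration.integrable_bound[OF tail])
      (use tail_le in \<open>auto intro: order_trans[OF _ abs_ge_self]\<close>)
  from Bochner_Integration.integrable_add[OF this intcc]
  show intUV: "integrable M (\<lambda>x. U x * V x)" by simp
  have 1: "\<bar>expectation (\<lambda>x. U x * V x) - expectation (\<lambda>x. cU x * cV x)\<bar> \<le> 2 * N powr (2 - p) * (K + K)"
  proof -
    have "\<bar>expectation (\<lambda>x. U x * V x) - expectation (\<lambda>x. cU x * cV x)\<bar>
        \<le> expectation (\<lambda>x. 2 * N powr (2 - p) * (\<bar>U x\<bar> powr p + \<bar>V x\<bar> powr p))"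
      by (rule abs_expectation_diff_le[OF intUV intcc tail]) (rule tail_le)
    also have "\<dots> = 2 * N powr (2 - p) * (expectation (\<lambda>x. \<bar>U x\<bar> powr p) + expectation (\<lambda>x. \<bar>V x\<bar> powr p))"
      using iU iV by simp
    also have "\<dots> \<le> 2 * N powr (2 - p) * (K + K)"
      by (intro mult_left_mono add_mono K) auto
    finally show ?thesis .
  qed
  have *: "\<bar>expectation W - expectation (\<lambda>x. truncated N (W x))\<bar> \<le> N powr (2 - p) * K \<and> \<bar>expectation W\<bar> \<le> 2 * K \<and> \<bar>expectation (\<lambda>x. truncated N (W x))\<bar> \<le> 2 * K"
    if W: "integrable M W" "integrable M (\<lambda>x. \<bar>W x\<bar> powr p)" "expectation (\<lambda>x. \<bar>W x\<bar> powr p) \<le> K"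
      "integrable M (\<lambda>x. truncated N (W x))" for W
  proof (intro conjI)
    have "\<bar>expectation W - expectation (\<lambda>x. truncated N (W x))\<bar> \<le> expectation (\<lambda>x. N powr (1 - p) * \<bar>W x\<bar> powr p)"
      by (rule abs_expectation_diff_le) (use W N0 p abs_diff_truncated_le_powr in auto)
    also have "\<dots> \<le> N powr (1 - p) * K"
      using W by (simp add: mult_left_mono)
    \<comment> \<open>Since \<open>N \<ge> 1\<close>, the better power for a single variable may be
      weakened to the one that occurs for products, so that all errors have the same order.\<close>
    also have "\<dots> \<le> N powr (2 - p) * K"
      using N1 K by (intro mult_right_mono powr_mono) auto
    finally show "\<bar>expectation W - expectation (\<lambda>x. truncated N (W x))\<bar> \<le> N powr (2 - p) * K" .
    have i: "integrable M (\<lambda>x. 1 + \<bar>W x\<bar> powr p)" and c: "integrable M (\<lambda>_. 0::real)" using W by auto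
    have E: "expectation (\<lambda>x. 1 + \<bar>W x\<bar> powr p) \<le> 2 * K"
      using W K by (simp add: prob_space)
    have "\<bar>expectation W - expectation (\<lambda>_. 0)\<bar> \<le> expectation (\<lambda>x. 1 + \<bar>W x\<bar> powr p)"
      by (rule abs_expectation_diff_le[OF W(1) c i]) (use abs_le_1_plus_powr[of p] p in auto)
    then show "\<bar>expectation W\<bar> \<le> 2 * K" using E by simp
    have "\<bar>expectation (\<lambda>x. truncated N (W x)) - expectation (\<lambda>_. 0)\<bar> \<le> expectation (\<lambda>x. 1 + \<bar>W x\<bar> powr p)"
      by (rule abs_expectation_diff_le[OF W(4) c i])
        (use abs_le_1_plus_powr[of p] p N0 in \<open>auto intro: order_trans[OF abs_truncated_le_abs]\<close>)
    then show "\<bar>expectation (\<lambda>x. truncated N (W x))\<bar> \<le> 2 * K" using E by simp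
  qed
  have 2: "\<bar>expectation U * expectation V - expectation cU * expectation cV\<bar> \<le>
      N powr (2 - p) * K * (2 * K) + 2 * K * (N powr (2 - p) * K)"
    by (rule abs_mult_diff_le)
      (use *[OF intU iU K(1) intc(1)[unfolded cU_def]] *[OF intV iV K(2) intc(2)[unfolded cV_def]]
       in \<open>auto simp: cU_def cV_def\<close>)
  have 3: "\<bar>expectation (\<lambda>x. cU x * cV x) - expectation cU * expectation cV\<bar> \<le> 4 * N\<^sup>2 * a"
    by (rule covariance_bounded_le)
      (use cN N0 in \<open>auto simp: cU_def cV_def intro!: dependence_le_compose[OF dep]\<close>)
  define t where "t = a powr (1 - 2 / p)"
  have "\<bar>expectation (\<lambda>x. U x * V x) - expectation U * expectation V\<bar> \<le>
      2 * t * (K + K) + (t * K * (2 * K) + 2 * K * (t * K)) + 4 * t"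
    using 1 2 3 unfolding Np mult.assoc[of 4] Na t_def[symmetric] by linarith
  also have "\<dots> = (4 + 4 * K + 4 * K\<^sup>2) * t" by (simp add: algebra_simps power2_eq_square)
  finally show "\<bar>expectation (\<lambda>x. U x * V x) - expectation U * expectation V\<bar> \<le> (4 + 4 * K + 4 * K\<^sup>2) * a powr (1 - 2 / p)"
    unfolding t_def .
qed

end

subsection \<open>A maximal inequality for weighted sums\<close>

text \<open>For fixed \<open>i\<close> every distance occurs at most once on each side of
  \<open>i\<close>, which gives the factor 2. The conditional expresses the distance of two natural
  numbers, as plain subtraction truncates at 0.\<close>

lemma sum_nat_dist_le:
  fixes c :: "nat \<Rightarrow> real"
  assumes c: "summable c" "\<And>n. 0 \<le> c n" and I: "finite I"
  shows "(\<Sum>i\<in>I. \<Sum>j\<in>I. c (if i \<le> j then j - i else i - j)) \<le> 2 * suminf c * real (card I)"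
proof -
  have "(\<Sum>j\<in>I. c (if i \<le> j then j - i else i - j)) \<le> 2 * suminf c" for i
  proof -
    have "(\<Sum>j\<in>I. c (if i \<le> j then j - i else i - j))
        = (\<Sum>j\<in>{j\<in>I. i \<le> j}. c (j - i)) + (\<Sum>j\<in>{j\<in>I. \<not> i \<le> j}. c (i - j))"
      unfolding if_distrib[of c] by (subst sum.If_cases[OF I]) (simp add: Int_def)
    also have "(\<Sum>j\<in>{j\<in>I. i \<le> j}. c (j - i)) = sum c ((\<lambda>j. j - i) ` {j\<in>I. i \<le> j})"
      by (subst sum.reindex) (auto simp: inj_on_def)
    also have "\<dots> \<le> suminf c" by (rule sum_le_suminf) (use c I in auto)
    also have "(\<Sum>j\<in>{j\<in>I. \<not> i \<le> j}. c (i - j)) = sum c ((\<lambda>j. i - j) ` {j\<in>I. \<not> i \<le> j})"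
      by (subst sum.reindex) (auto simp: inj_on_def)
    also have "\<dots> \<le> suminf c" by (rule sum_le_suminf) (use c I in auto)
    finally show ?thesis by simp
  qed
  then have "(\<Sum>i\<in>I. \<Sum>j\<in>I. c (if i \<le> j then j - i else i - j)) \<le> real (card I) * (2 * suminf c)"
    by (intro sum_bounded_above)
  then show ?thesis by (simp add: algebra_simps)
qed

text \<open>Chebyshev's inequality, with the second moment expanded into a double sum of mixed
  moments that depend on the distance of the indices.\<close>

lemma (in prob_space) prob_weighted_sum_le:
  fixes Z :: "nat \<Rightarrow> 'a \<Rightarrow> real" and w :: "nat \<Rightarrow> real"
  assumes [measurable]: "\<And>i. Z i \<in> borel_measurable M"
    and int: "\<And>i j. i \<le> j \<Longrightarrow> integrable M (\<lambda>x. Z i x * Z j x)"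
    and cov: "\<And>i j. i \<le> j \<Longrightarrow> \<bar>expectation (\<lambda>x. Z i x * Z j x)\<bar> \<le> c (j - i)"
    and c: "summable c" and I: "finite I" and w: "\<And>i. i \<in> I \<Longrightarrow> \<bar>w i\<bar> \<le> 1" and y: "0 < y"
  shows "prob {x \<in> space M. y < \<bar>\<Sum>i\<in>I. w i * Z i x\<bar>} \<le> 2 * suminf c * real (card I) / y\<^sup>2"
proof -
  have c0: "0 \<le> c n" for n using cov[of 0 n] by simp
  have int': "integrable M (\<lambda>x. Z i x * Z j x)" for i j
    using int[of i j] int[of j i] by (cases "i \<le> j") (auto simp: mult.commute)
  have cov': "\<bar>expectation (\<lambda>x. Z i x * Z j x)\<bar> \<le> c (if i \<le> j then j - i else i - j)" for i j
    using cov[of i j] cov[of j i] by (cases "i \<le> j") (auto simp: mult.commute)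
  have sq: "(\<Sum>i\<in>I. w i * Z i x)\<^sup>2 = (\<Sum>i\<in>I. \<Sum>j\<in>I. w i * w j * (Z i x * Z j x))" for x
    by (simp add: power2_eq_square sum_product algebra_simps)
  have int_sq: "integrable M (\<lambda>x. (\<Sum>i\<in>I. w i * Z i x)\<^sup>2)"
    unfolding sq by (intro Bochner_Integration.integrable_sum integrable_mult_right int')
  have "expectation (\<lambda>x. (\<Sum>i\<in>I. w i * Z i x)\<^sup>2) = (\<Sum>i\<in>I. \<Sum>j\<in>I. w i * w j * expectation (\<lambda>x. Z i x * Z j x))"
    unfolding sq by (simp add: Bochner_Integration.integral_sum int')
  also have "\<dots> \<le> (\<Sum>i\<in>I. \<Sum>j\<in>I. c (if i \<le> j then j - i else i - j))"
  proof (intro sum_mono)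
    fix i j assume "i \<in> I" "j \<in> I"
    then have "\<bar>w i * w j\<bar> \<le> 1 * 1" unfolding abs_mult by (intro mult_mono w) auto
    then have "\<bar>w i * w j * expectation (\<lambda>x. Z i x * Z j x)\<bar> \<le> 1 * c (if i \<le> j then j - i else i - j)"
      unfolding abs_mult[of "w i * w j"] by (intro mult_mono cov') auto
    then show "w i * w j * expectation (\<lambda>x. Z i x * Z j x) \<le> c (if i \<le> j then j - i else i - j)" by linarith
  qed
  also have "\<dots> \<le> 2 * suminf c * real (card I)" by (rule sum_nat_dist_le[OF c c0 I])
  finally have E: "expectation (\<lambda>x. (\<Sum>i\<in>I. w i * Z i x)\<^sup>2) \<le> 2 * suminf c * real (card I)" .
  have "prob {x \<in> space M. y < \<bar>\<Sum>i\<in>I. w i * Z i x\<bar>} \<le> prob {x \<in> space M. y \<le> \<bar>\<Sum>i\<in>I. w i * Z i x\<bar>}"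
    by (rule finite_measure_mono) auto
  also have "\<dots> \<le> expectation (\<lambda>x. (\<Sum>i\<in>I. w i * Z i x)\<^sup>2) / y\<^sup>2"
    by (rule second_moment_method) (use int_sq y in auto)
  also have "\<dots> \<le> 2 * suminf c * real (card I) / y\<^sup>2"
    by (rule divide_right_mono[OF E]) simp
  finally show ?thesis .
qed

section \<open>First passage argument for the partial sums\<close>

text \<open>These are the consequences of Assumption E that the maximal inequality uses. Covariances
  of the absolute values are included because the gap after a first passage has a random position
  and is controlled by sums of absolute values over fixed blocks.\<close>

locale short_range_process = prob_space M for M :: "'a measure" +
  fixes X :: "nat \<Rightarrow> 'a \<Rightarrow> real" and c :: "nat \<Rightarrow> real"
  assumes meas [measurable]: "\<And>i. X i \<in> borel_measurable M"
    and integrable_X: "\<And>i. integrable M (X i)"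
    and mean0: "\<And>i. expectation (X i) = 0"
    and abs_mean: "\<And>i. expectation (\<lambda>x. \<bar>X i x\<bar>) \<le> 1"
    and integrable_mult: "\<And>i j. i \<le> j \<Longrightarrow> integrable M (\<lambda>x. X i x * X j x)"
    and cov: "\<And>i j. i \<le> j \<Longrightarrow> \<bar>expectation (\<lambda>x. X i x * X j x)\<bar> \<le> c (j - i)"
    and cov_abs: "\<And>i j. i \<le> j \<Longrightarrow> \<bar>expectation (\<lambda>x. \<bar>X i x\<bar> * \<bar>X j x\<bar>) -
        expectation (\<lambda>x. \<bar>X i x\<bar>) * expectation (\<lambda>x. \<bar>X j x\<bar>)\<bar> \<le> c (j - i)"
    and summable_c: "summable c"
    and summable_alpha: "summable (\<lambda>n. real n * alpha_mix M X n)"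
begin

abbreviation partial :: "(nat \<Rightarrow> real) \<Rightarrow> nat set \<Rightarrow> 'a \<Rightarrow> real" where
  "partial w I x \<equiv> (\<Sum>i\<in>I. w i * X i x)"

lemma prob_partial_le:
  assumes "finite I" "\<And>i. i \<in> I \<Longrightarrow> \<bar>w i\<bar> \<le> 1" "0 < y"
  shows "prob {x \<in> space M. y < \<bar>partial w I x\<bar>} \<le> 2 * suminf c * real (card I) / y\<^sup>2"
  by (rule prob_weighted_sum_le) (use assms integrable_mult cov summable_c in auto)

text \<open>The means of the absolute values over \<open>I\<close> sum to at most
  \<open>card I\<close>, hence to at most \<open>y\<close>. A sum above \<open>2 * y\<close>
  therefore forces the centred sum above \<open>y\<close>, to which the second moment bound
  applies.\<close>

lemma prob_abs_block_le:
  assumes I: "finite I" "real (card I) \<le> y" and y: "0 < y"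
  shows "prob {x \<in> space M. 2 * y < (\<Sum>i\<in>I. \<bar>X i x\<bar>)} \<le> 2 * suminf c * real (card I) / y\<^sup>2"
proof -
  define e where "e = (\<lambda>i. expectation (\<lambda>x. \<bar>X i x\<bar>))"
  define Z where "Z = (\<lambda>i x. \<bar>X i x\<bar> - e i)"
  have [measurable]: "Z i \<in> borel_measurable M" for i by (simp add: Z_def)
  have iX: "integrable M (\<lambda>x. \<bar>X i x\<bar>)" for i using integrable_X by simp
  have iXX: "integrable M (\<lambda>x. \<bar>X i x\<bar> * \<bar>X j x\<bar>)" if "i \<le> j" for i j
    using integrable_abs[OF integrable_mult[OF that]] by (simp add: abs_mult)
  have ZZ: "Z i x * Z j x = \<bar>X i x\<bar> * \<bar>X j x\<bar> - e j * \<bar>X i x\<bar> - e i * \<bar>X j x\<bar> + e i * e j" for i j x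
    by (simp add: Z_def algebra_simps)
  have "integrable M (\<lambda>x. Z i x * Z j x)" if "i \<le> j" for i j
    unfolding ZZ using iXX[OF that] iX by auto
  moreover have "expectation (\<lambda>x. Z i x * Z j x) = expectation (\<lambda>x. \<bar>X i x\<bar> * \<bar>X j x\<bar>) - e i * e j" if "i \<le> j" for i j
    unfolding ZZ using iXX[OF that] iX by (simp add: prob_space e_def)
  ultimately have "prob {x \<in> space M. y < \<bar>\<Sum>i\<in>I. 1 * Z i x\<bar>} \<le> 2 * suminf c * real (card I) / y\<^sup>2"
    by (intro prob_weighted_sum_le) (use cov_abs summable_c I y in \<open>auto simp: e_def\<close>)
  moreover have "prob {x \<in> space M. 2 * y < (\<Sum>i\<in>I. \<bar>X i x\<bar>)} \<le> prob {x \<in> space M. y < \<bar>\<Sum>i\<in>I. 1 * Z i x\<bar>}"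
  proof (rule finite_measure_mono)
    have "sum e I \<le> real (card I) * 1"
      by (rule sum_bounded_above) (simp add: e_def abs_mean)
    then have "y < \<bar>\<Sum>i\<in>I. 1 * Z i x\<bar>" if "2 * y < (\<Sum>i\<in>I. \<bar>X i x\<bar>)" for x
      using that I by (simp add: Z_def sum_subtractf)
    then show "{x \<in> space M. 2 * y < (\<Sum>i\<in>I. \<bar>X i x\<bar>)} \<subseteq> {x \<in> space M. y < \<bar>\<Sum>i\<in>I. 1 * Z i x\<bar>}" by blast
  qed measurable
  ultimately show ?thesis by linarith
qed

text \<open>At the first passage time \<open>k\<close>, one of the sums over the gap \<open>{k..<k+q}\<close>, over \<open>{k+q..<n}\<close>
  and over \<open>{..<n}\<close> is large. The second one is almost independent of the passage, and the gap is
  controlled through blocks of length \<open>q\<close>; taking \<open>q\<close> proportional to \<open>y\<close> makes the mixing error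
  \<open>n * \<alpha>(q)\<close> of the order \<open>n / y\<^sup>2\<close>.\<close>
theorem maximal_inequality:
  assumes w: "\<And>i. i < n \<Longrightarrow> \<bar>w i\<bar> \<le> 1" and y: "0 < y"
  defines "K \<equiv> 36 * suminf c + 256 * (\<Sum>j. real j * alpha_mix M X j) + 16"
  shows "prob {x \<in> space M. \<exists>k\<le>n. 3 * y < \<bar>partial w {..<k} x\<bar>} \<le> K * real n / y\<^sup>2"
proof -
  define S where "S = (\<Sum>j. real j * alpha_mix M X j)"
  have S0: "0 \<le> S" unfolding S_def
    by (intro suminf_nonneg summable_alpha) (simp add: alpha_mix_bounds)
  have c0: "0 \<le> c j" for j using cov[of 0 j] by simp
  have C0: "0 \<le> suminf c" by (intro suminf_nonneg summable_c c0)
  define Bad where "Bad = {x \<in> space M. \<exists>k\<le>n. 3 * y < \<bar>partial w {..<k} x\<bar>}"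
  show ?thesis
  proof (cases "n = 0")
    case True
    then show ?thesis using y by simp
  next
    case n: False
    show ?thesis
    proof (cases "y < 4")
      case True
      \<comment> \<open>For \<open>y < 4\<close> the claimed bound is at least 1, thanks to the
        summand 16 in \<open>K\<close>. In the other case \<open>y / 4\<close> is at least 1, so a
        positive block length exists.\<close>
      have "y\<^sup>2 \<le> 4\<^sup>2" by (rule power_mono) (use True y in auto)
      also have "\<dots> \<le> K * 1" using S0 C0 by (simp add: K_def S_def)
      also have "\<dots> \<le> K * real n" by (rule mult_left_mono) (use n S0 C0 in \<open>auto simp: K_def S_def\<close>)
      finally have "1 \<le> K * real n / y\<^sup>2" using y by simp
      then show ?thesis using prob_le_1 order_trans by blast
    next
      case y4: False
      define q where "q = nat \<lfloor>y / 4\<rfloor>"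
      have "real q = of_int \<lfloor>y / 4\<rfloor>" using y by (simp add: q_def)
      moreover have "1 \<le> \<lfloor>y / 4\<rfloor>" using y4 by simp
      ultimately have q: "real q \<le> y / 4" "y / 8 \<le> real q" "0 < q" by linarith+
      \<comment> \<open>The blocks \<open>I j\<close> have length at most
        \<open>q \<le> y / 4\<close>, as the bound for sums of absolute values requires.
        \<open>A k\<close> is first passage at \<open>k\<close>, \<open>F k\<close> a large sum
        after the gap, \<open>G\<close> a large total, and \<open>H j\<close> a large block. The gap
        meets at most two consecutive blocks, so the threshold \<open>y / 2\<close> per block is
        enough.\<close>
      define I where "I = (\<lambda>j. {i. i < n \<and> i div q = j})"
      define A where "A = (\<lambda>k. {x \<in> space M. 3 * y < \<bar>partial w {..<k} x\<bar> \<and> (\<forall>j\<in>{..<k}. \<bar>partial w {..<j} x\<bar> \<le> 3 * y)})"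
      define F where "F = (\<lambda>k. {x \<in> space M. y < \<bar>partial w {k+q..<n} x\<bar>})"
      define G where "G = {x \<in> space M. y < \<bar>partial w {..<n} x\<bar>}"
      define H where "H = (\<lambda>j. {x \<in> space M. 2 * (y / 4) < (\<Sum>i\<in>I j. \<bar>X i x\<bar>)})"
      have [measurable]: "A k \<in> sets M" "F k \<in> sets M" "G \<in> sets M" "H j \<in> sets M" for k j
        by (simp_all add: A_def F_def G_def H_def)

      have sub: "Bad \<subseteq> G \<union> (\<Union>j\<in>{..n+1}. H j) \<union> (\<Union>k\<in>{..n}. A k \<inter> F k)"
      proof
        fix x assume "x \<in> Bad"
        then have x: "x \<in> space M" and ex: "\<exists>k. k \<le> n \<and> 3 * y < \<bar>partial w {..<k} x\<bar>" by (auto simp: Bad_def)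
        define k where "k = (LEAST k. k \<le> n \<and> 3 * y < \<bar>partial w {..<k} x\<bar>)"
        have k: "k \<le> n" "3 * y < \<bar>partial w {..<k} x\<bar>" using LeastI_ex[OF ex] by (simp_all add: k_def)
        have "\<bar>partial w {..<j} x\<bar> \<le> 3 * y" if "j < k" for j
          using not_less_Least[of j "\<lambda>k. k \<le> n \<and> 3 * y < \<bar>partial w {..<k} x\<bar>"] that k by (auto simp: k_def)
        then have kA: "x \<in> A k" using k x by (simp add: A_def)
        show "x \<in> G \<union> (\<Union>j\<in>{..n+1}. H j) \<union> (\<Union>k\<in>{..n}. A k \<inter> F k)"
        proof (rule ccontr)
          assume "\<not> ?thesis"
          then have nG: "x \<notin> G" and nH: "\<And>j. j \<le> n + 1 \<Longrightarrow> x \<notin> H j" and nF: "x \<notin> F k"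
            using kA k by auto
          \<comment> \<open>The gap is cut off at \<open>n\<close>, since \<open>k + q\<close> may
            exceed \<open>n\<close>; the sum after the gap is then empty. With the total and the
            later sum at most \<open>y\<close>, a passage above \<open>3 * y\<close> leaves more
            than \<open>y\<close> for the gap.\<close>
          define J where "J = {k..<k+q} \<inter> {..<n}"
          have "partial w {..<n} x = partial w ({..<k} \<union> (J \<union> {k+q..<n})) x"
            by (rule sum.cong) (use k in \<open>auto simp: J_def\<close>)
          also have "\<dots> = partial w {..<k} x + (partial w J x + partial w {k+q..<n} x)"
            by (subst sum.union_disjoint; (subst sum.union_disjoint)?) (auto simp: J_def)
          finally have split: "partial w {..<n} x = partial w {..<k} x + (partial w J x + partial w {k+q..<n} x)" .
          have "\<bar>partial w {..<n} x\<bar> \<le> y" "\<bar>partial w {k+q..<n} x\<bar> \<le> y" using nG nF x by (auto simp: G_def F_def)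
          then have "y < \<bar>partial w J x\<bar>" using split k by linarith
          also have "\<dots> \<le> (\<Sum>i\<in>J. \<bar>X i x\<bar>)"
          proof (rule order_trans[OF sum_abs sum_mono])
            fix i assume "i \<in> J"
            then show "\<bar>w i * X i x\<bar> \<le> \<bar>X i x\<bar>"
              using mult_right_mono[OF w, of i "\<bar>X i x\<bar>"] by (simp add: J_def abs_mult)
          qed
          also have "\<dots> \<le> (\<Sum>i\<in>I (k div q) \<union> I (k div q + 1). \<bar>X i x\<bar>)"
          proof (rule sum_mono2)
            show "J \<subseteq> I (k div q) \<union> I (k div q + 1)"
            proof
              fix i assume i: "i \<in> J"
              have "k div q \<le> i div q" using i by (intro div_le_mono) (simp add: J_def)
              moreover have "i div q \<le> (k + q) div q" using i by (intro div_le_mono) (simp add: J_def)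
              moreover have "(k + q) div q = k div q + 1" using q by simp
              ultimately show "i \<in> I (k div q) \<union> I (k div q + 1)" using i by (auto simp: I_def J_def)
            qed
          qed (auto simp: I_def)
          also have "\<dots> = (\<Sum>i\<in>I (k div q). \<bar>X i x\<bar>) + (\<Sum>i\<in>I (k div q + 1). \<bar>X i x\<bar>)"
            by (rule sum.union_disjoint) (auto simp: I_def)
          also have "\<dots> \<le> 2 * (y / 4) + 2 * (y / 4)"
          proof (rule add_mono)
            have "k div q \<le> n" using k div_le_dividend order_trans by blast
            then show "(\<Sum>i\<in>I (k div q). \<bar>X i x\<bar>) \<le> 2 * (y / 4)" "(\<Sum>i\<in>I (k div q + 1). \<bar>X i x\<bar>) \<le> 2 * (y / 4)"
              using nH[of "k div q"] nH[of "k div q + 1"] x by (simp_all add: H_def)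
          qed
          finally show False by simp
        qed
      qed

      have PG: "prob G \<le> 2 * suminf c * real n / y\<^sup>2"
        using prob_partial_le[of "{..<n}" w y] w y by (simp add: G_def)

      have PH: "prob (\<Union>j\<in>{..n+1}. H j) \<le> 32 * suminf c * real n / y\<^sup>2"
      proof -
        have "prob (H j) \<le> 2 * suminf c * real (card (I j)) / (y / 4)\<^sup>2" for j
          unfolding H_def
        proof (rule prob_abs_block_le)
          have "I j \<subseteq> {j * q..<j * q + q}"
          proof
            fix i assume "i \<in> I j"
            then have "i div q = j" by (simp add: I_def)
            moreover have "i div q * q + i mod q = i" by simp
            moreover have "i mod q < q" using q by simp
            ultimately show "i \<in> {j * q..<j * q + q}" by auto
          qed
          then have "card (I j) \<le> card {j * q..<j * q + q}" by (intro card_mono) auto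
          then show "real (card (I j)) \<le> y / 4" using q by simp
        qed (use y in \<open>auto simp: I_def\<close>)
        then have "(\<Sum>j\<in>{..n+1}. prob (H j)) \<le> (\<Sum>j\<in>{..n+1}. 2 * suminf c * real (card (I j)) / (y / 4)\<^sup>2)"
          by (rule sum_mono)
        also have "\<dots> = 32 * suminf c / y\<^sup>2 * (\<Sum>j\<in>{..n+1}. real (card (I j)))"
          unfolding sum_distrib_left by (rule sum.cong) (simp_all add: power_divide)
        \<comment> \<open>The blocks partition \<open>{..<n}\<close>, so summing the block bounds
          gives order \<open>n\<close>, whatever the block length.\<close>
        also have "(\<Sum>j\<in>{..n+1}. real (card (I j))) = real n"
        proof -
          have "(\<Sum>j\<in>{..n+1}. sum (\<lambda>_. 1::real) {i. i \<in> {..<n} \<and> i div q = j}) = sum (\<lambda>_. 1) {..<n}"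
            by (rule sum.group) (auto intro: order_trans[OF div_le_dividend])
          then show ?thesis by (simp add: I_def)
        qed
        finally have "(\<Sum>j\<in>{..n+1}. prob (H j)) \<le> 32 * suminf c * real n / y\<^sup>2" by simp
        moreover have "prob (\<Union>j\<in>{..n+1}. H j) \<le> (\<Sum>j\<in>{..n+1}. prob (H j))"
          by (rule finite_measure_subadditive_finite) auto
        ultimately show ?thesis by linarith
      qed

      \<comment> \<open>First passage events are disjoint, so the product terms
        \<open>prob (A k) * v\<close> sum to at most \<open>v\<close>. Only the mixing error is paid
        \<open>n + 1\<close> times, and \<open>q \<ge> y / 8\<close> turns it into order
        \<open>n / y\<^sup>2\<close>.\<close>
      have PA: "prob (\<Union>k\<in>{..n}. A k \<inter> F k) \<le> 2 * suminf c * real n / y\<^sup>2 + 256 * S * real n / y\<^sup>2"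
      proof -
        define v where "v = 2 * suminf c * real n / y\<^sup>2"
        have v0: "0 \<le> v" using C0 by (simp add: v_def)
        have PF: "prob (F k) \<le> v" for k
        proof -
          have "prob (F k) \<le> 2 * suminf c * real (card {k+q..<n}) / y\<^sup>2"
            unfolding F_def by (rule prob_partial_le) (use w y in auto)
          also have "\<dots> \<le> v"
            unfolding v_def by (intro divide_right_mono mult_left_mono) (use C0 in auto)
          finally show ?thesis .
        qed
        have one: "prob (A k \<inter> F k) \<le> prob (A k) * v + alpha_mix M X q" for k
        proof -
          \<comment> \<open>\<open>A k\<close> depends on the variables with index below
            \<open>k\<close>. It is placed in the past up to \<open>k\<close> because the
            coefficient at lag \<open>q\<close> pairs \<open>{..k}\<close> with
            \<open>{k+q..}\<close>.\<close>
          have past: "A k \<in> gen_sigma M X {..k}"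
          proof -
            have P: "partial w {..<j} \<in> borel_measurable (gen_algebra M X {..k})" if "j \<le> k" for j
              by (intro borel_measurable_sum borel_measurable_times borel_measurable_const measurable_gen_algebra)
                (use that in auto)
            have "{x \<in> space (gen_algebra M X {..k}). 3 * y < \<bar>partial w {..<k} x\<bar> \<and> (\<forall>j\<in>{..<k}. \<bar>partial w {..<j} x\<bar> \<le> 3 * y)}
                \<in> sets (gen_algebra M X {..k})"
              by (intro sets.sets_Collect_conj sets.sets_Collect_finite_All borel_measurable_less borel_measurable_le
                borel_measurable_abs borel_measurable_const P) auto
            then show ?thesis by (simp add: A_def sets_gen_algebra)
          qed
          have future: "F k \<in> gen_sigma M X {k+q..}"
          proof -
            have P: "partial w {k+q..<n} \<in> borel_measurable (gen_algebra M X {k+q..})"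
              by (intro borel_measurable_sum borel_measurable_times borel_measurable_const measurable_gen_algebra) auto
            have "{x \<in> space (gen_algebra M X {k+q..}). y < \<bar>partial w {k+q..<n} x\<bar>} \<in> sets (gen_algebra M X {k+q..})"
              by (intro borel_measurable_less borel_measurable_abs borel_measurable_const P)
            then show ?thesis by (simp add: F_def sets_gen_algebra)
          qed
          have "prob (A k \<inter> F k) \<le> prob (A k) * prob (F k) + alpha_mix M X q"
            using alpha_mix_ge[OF past future] by linarith
          also have "prob (A k) * prob (F k) \<le> prob (A k) * v" by (intro mult_left_mono PF) auto
          finally show ?thesis by simp
        qed
        have disj: "disjoint_family_on A {..n}"
        proof -
          have "A k \<inter> A l = {}" if "k < l" for k l using that by (force simp: A_def)
          then show ?thesis unfolding disjoint_family_on_def by (metis Int_commute nat_neq_iff)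
        qed
        have sumA: "(\<Sum>k\<le>n. prob (A k)) \<le> 1"
        proof -
          have "(\<Sum>k\<le>n. prob (A k)) = prob (\<Union>k\<in>{..n}. A k)"
            by (rule finite_measure_finite_Union[symmetric]) (use disj in auto)
          then show ?thesis by simp
        qed
        have alpha: "real (n + 1) * alpha_mix M X q \<le> 256 * S * real n / y\<^sup>2"
        proof -
          have "(y / 8)\<^sup>2 * alpha_mix M X q \<le> (real q)\<^sup>2 * alpha_mix M X q"
            by (intro mult_right_mono power_mono) (use q y alpha_mix_bounds in auto)
          also have "\<dots> \<le> 2 * S" unfolding S_def by (rule alpha_mix_square_le[OF summable_alpha])
          finally have "alpha_mix M X q \<le> 128 * S / y\<^sup>2" using y by (simp add: field_simps)
          then have "real (n + 1) * alpha_mix M X q \<le> (2 * real n) * (128 * S / y\<^sup>2)"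
            by (intro mult_mono) (use n alpha_mix_bounds in auto)
          also have "\<dots> = 256 * S * real n / y\<^sup>2" by simp
          finally show ?thesis .
        qed
        have "prob (\<Union>k\<in>{..n}. A k \<inter> F k) \<le> (\<Sum>k\<le>n. prob (A k \<inter> F k))"
          by (rule finite_measure_subadditive_finite) auto
        also have "\<dots> \<le> (\<Sum>k\<le>n. prob (A k) * v + alpha_mix M X q)" by (rule sum_mono[OF one])
        also have "\<dots> = (\<Sum>k\<le>n. prob (A k)) * v + real (n + 1) * alpha_mix M X q"
          by (simp add: sum.distrib sum_distrib_right)
        also have "\<dots> \<le> 1 * v + 256 * S * real n / y\<^sup>2"
          by (intro add_mono mult_right_mono sumA v0 alpha)
        finally show ?thesis by (simp add: v_def)
      qed

      have "prob Bad \<le> prob (G \<union> (\<Union>j\<in>{..n+1}. H j) \<union> (\<Union>k\<in>{..n}. A k \<inter> F k))"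
        by (rule finite_measure_mono[OF sub]) auto
      also have "\<dots> \<le> prob G + prob (\<Union>j\<in>{..n+1}. H j) + prob (\<Union>k\<in>{..n}. A k \<inter> F k)"
        by (intro order_trans[OF measure_Un_le] add_mono order_refl) auto
      also have "\<dots> \<le> 2 * suminf c * real n / y\<^sup>2 + 32 * suminf c * real n / y\<^sup>2
          + (2 * suminf c * real n / y\<^sup>2 + 256 * S * real n / y\<^sup>2)"
        by (intro add_mono PG PH PA)
      also have "\<dots> = (36 * suminf c + 256 * S) * real n / y\<^sup>2"
        using y by (simp add: field_simps)
      also have "\<dots> \<le> K * real n / y\<^sup>2"
        by (intro divide_right_mono mult_right_mono) (simp_all add: K_def S_def)
      finally show ?thesis by (simp add: Bad_def)
    qed
  qed
qed

end

section \<open>Consequences of stationarity and Assumption E\<close>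

text \<open>Coordinate 0 of the path shifted by \<open>i\<close> is \<open>X i\<close>, so the claim
  is the equality of the path laws projected to that coordinate.\<close>

lemma distr_strictly_stationary:
  assumes [measurable]: "\<And>i. X i \<in> borel_measurable M" and "strictly_stationary M X"
  shows "distr M borel (X i) = distr M borel (X 0)"
proof -
  have "(\<lambda>x j. X (j + h) x) \<in> M \<rightarrow>\<^sub>M PiM UNIV (\<lambda>_. borel)" for h
    by (rule measurable_PiM_single') auto
  then have marginal: "distr (distr M (PiM UNIV (\<lambda>_. borel)) (\<lambda>x j. X (j + h) x)) borel (\<lambda>f. f 0) = distr M borel (X h)" for h
    by (subst distr_distr) (simp_all add: comp_def)
  have "distr (distr M (PiM UNIV (\<lambda>_. borel)) (\<lambda>x j. X (j + i) x)) borel (\<lambda>f. f 0)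
      = distr (distr M (PiM UNIV (\<lambda>_. borel)) (\<lambda>x j. X j x)) borel (\<lambda>f. f 0)"
    using assms(2) by (simp add: strictly_stationary_def)
  then show ?thesis using marginal[of i] marginal[of 0] by simp
qed

lemma stationary_moment:
  fixes g :: "real \<Rightarrow> real"
  assumes "\<And>i. X i \<in> borel_measurable M" "strictly_stationary M X" "g \<in> borel_measurable borel"
  shows "integral\<^sup>L M (\<lambda>x. g (X i x)) = integral\<^sup>L M (\<lambda>x. g (X 0 x))"
    and "integrable M (\<lambda>x. g (X i x)) \<longleftrightarrow> integrable M (\<lambda>x. g (X 0 x))"
  using integral_distr[of "X i" M borel g] integral_distr[of "X 0" M borel g]
    integrable_distr_eq[of "X i" M borel g] integrable_distr_eq[of "X 0" M borel g]
    distr_strictly_stationary[of X M i] assms by simp_all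

text \<open>The covariance inequality with exponent \<open>\<theta> = 1 - 2 / p\<close> supplies one
  sequence \<open>c\<close> for both the variables and their absolute values, and stationarity makes
  the moment bound \<open>K\<close> uniform. The mixing rate makes \<open>c\<close>
  summable.\<close>

lemma (in prob_space) assumption_E_imp_short_range_process:
  assumes "assumption_E M X"
  obtains c where "short_range_process M X c"
proof -
  note E = assms[unfolded assumption_E_def]
  have meas [measurable]: "X i \<in> borel_measurable M" for i using E by blast
  have stat: "strictly_stationary M X" using E by blast
  note moment = stationary_moment[of X M, OF meas stat]
  have int1: "integrable M (X i)" for i using moment(2)[of "\<lambda>u. u" i] E by simp
  have mean: "expectation (X i) = 0" for i using moment(1)[of "\<lambda>u. u" i] E by simp
  have sq0: "expectation (\<lambda>x. (X 0 x)\<^sup>2) = 1" and isq0: "integrable M (\<lambda>x. (X 0 x)\<^sup>2)"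
    using E mean[of 0] by simp_all
  have abs_mean: "expectation (\<lambda>x. \<bar>X i x\<bar>) \<le> 1" for i
  proof -
    have le: "\<bar>u\<bar> \<le> (1 + u\<^sup>2) / 2" for u :: real
    proof -
      have "0 \<le> (\<bar>u\<bar> - 1)\<^sup>2" by simp
      then show ?thesis by (simp add: power2_eq_square algebra_simps)
    qed
    have "expectation (\<lambda>x. \<bar>X i x\<bar>) = expectation (\<lambda>x. \<bar>X 0 x\<bar>)" using moment(1)[of abs i] by simp
    also have "\<dots> \<le> expectation (\<lambda>x. (1 + (X 0 x)\<^sup>2) / 2)"
      by (rule integral_mono) (use int1 isq0 le in auto)
    also have "\<dots> = 1" using isq0 sq0 by (simp add: prob_space)
    finally show ?thesis .
  qed
  obtain p r where p: "2 < p" and ip: "integrable M (\<lambda>x. \<bar>X 0 x\<bar> powr p)" and r: "2 < r" "r \<le> p"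
    and sum: "summable (\<lambda>n. rpow (alpha_mix M X (Suc n)) (2 * (1 / r - 1 / p)))"
    using E by blast
  define K where "K = max 1 (expectation (\<lambda>x. \<bar>X 0 x\<bar> powr p))"
  define \<theta> where "\<theta> = 1 - 2 / p"
  text \<open>The maximum makes the bound positive, as the truncation argument needs, even where \<open>\<alpha>(n) = 0\<close>.\<close>
  define a where "a = (\<lambda>n. max (alpha_mix M X n) ((1/2)^n))"
  define c where "c = (\<lambda>n. (4 + 4 * K + 4 * K\<^sup>2) * a n powr \<theta>)"
  have a: "0 < a n" "a n \<le> 1" "alpha_mix M X n \<le> a n" for n
    by (auto simp: a_def alpha_mix_bounds less_max_iff_disj power_le_one)
  have ipi: "integrable M (\<lambda>x. \<bar>X i x\<bar> powr p)" for i
    using moment(2)[of "\<lambda>u. \<bar>u\<bar> powr p" i] ip by simp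
  have K: "expectation (\<lambda>x. \<bar>X i x\<bar> powr p) \<le> K" "1 \<le> K" for i
    using moment(1)[of "\<lambda>u. \<bar>u\<bar> powr p" i] by (simp_all add: K_def)
  have dep: "dependence_le (X i) (X j) (a (j - i))" if "i \<le> j" for i j
    by (rule dependence_le_mono[OF dependence_le_alpha_mix[OF that] a(3)])
  have \<theta>: "0 < \<theta>" "2 * (1 / r - 1 / p) \<le> \<theta>" "0 \<le> 2 * (1 / r - 1 / p)"
    using p r by (auto simp: \<theta>_def field_simps)
  have "summable (\<lambda>n. a n powr \<theta>)"
  proof -
    \<comment> \<open>As \<open>r > 2\<close>, the exponent \<open>2 * (1 / r - 1 / p)\<close> is at
      most \<open>\<theta>\<close>, and coefficients in the unit interval decrease under larger
      exponents. For \<open>r = p\<close> the dominating term \<open>rpow\<close> is 1, which is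
      still an upper bound.\<close>
    have "summable (\<lambda>n. alpha_mix M X n powr \<theta>)"
    proof (subst summable_Suc_iff[symmetric], rule summable_comparison_test[OF _ sum], intro exI allI impI)
      fix n
      show "norm (alpha_mix M X (Suc n) powr \<theta>) \<le> rpow (alpha_mix M X (Suc n)) (2 * (1 / r - 1 / p))"
        unfolding rpow_def
        using \<theta> alpha_mix_bounds[where X = X and n = "Suc n"] powr_le1[of \<theta> "alpha_mix M X (Suc n)"]
          powr_mono'[of "2 * (1 / r - 1 / p)" \<theta> "alpha_mix M X (Suc n)"] by auto
    qed
    moreover have "summable (\<lambda>n. ((1/2) powr \<theta>) ^ n)"
      by (rule summable_geometric) (use powr_less_mono2[of \<theta> "1/2" 1] \<theta> in simp)
    ultimately have "summable (\<lambda>n. alpha_mix M X n powr \<theta> + ((1/2) powr \<theta>) ^ n)"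
      by (rule summable_add)
    then show ?thesis
    proof (rule summable_comparison_test[rotated], intro exI allI impI)
      fix n
      have "((1/2) ^ n) powr \<theta> = ((1/2 :: real) powr \<theta>) ^ n"
        by (simp add: powr_realpow[symmetric] powr_powr mult.commute)
      then show "norm (a n powr \<theta>) \<le> alpha_mix M X n powr \<theta> + ((1/2) powr \<theta>) ^ n"
        by (auto simp: a_def max_def)
    qed
  qed
  then have sc: "summable c" unfolding c_def by (rule summable_mult)
  show ?thesis
  proof (rule that[of c], unfold_locales)
    fix i j :: nat assume ij: "i \<le> j"
    note cov = covariance_powr_le[OF _ _ _ a(1,2)]
    show "integrable M (\<lambda>x. X i x * X j x)"
      by (rule cov(1)[OF _ _ dep[OF ij], of p K]) (use p ipi K in auto)
    have "\<bar>expectation (\<lambda>x. X i x * X j x) - expectation (X i) * expectation (X j)\<bar> \<le> c (j - i)"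
      unfolding c_def \<theta>_def by (rule cov(2)[OF _ _ dep[OF ij], of p K]) (use p ipi K in auto)
    then show "\<bar>expectation (\<lambda>x. X i x * X j x)\<bar> \<le> c (j - i)" by (simp add: mean)
    show "\<bar>expectation (\<lambda>x. \<bar>X i x\<bar> * \<bar>X j x\<bar>) - expectation (\<lambda>x. \<bar>X i x\<bar>) * expectation (\<lambda>x. \<bar>X j x\<bar>)\<bar> \<le> c (j - i)"
      unfolding c_def \<theta>_def
      by (rule cov(2)[OF _ _ dependence_le_compose[OF dep[OF ij]], of abs abs p K]) (use p ipi K in auto)
  qed (use int1 mean abs_mean sc E in auto)
qed

subsection \<open>Consistency under the alternative\<close>

lemma (in prob_space) prob_tendsto_1:
  assumes E: "\<And>n. E n \<in> sets M" and B: "\<And>n. B n \<in> sets M"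
    and sub: "eventually (\<lambda>n. space M - B n \<subseteq> E n) F" and lim: "((\<lambda>n. prob (B n)) \<longlongrightarrow> 0) F"
  shows "((\<lambda>n. prob (E n)) \<longlongrightarrow> 1) F"
proof (rule tendsto_sandwich)
  show "eventually (\<lambda>n. 1 - prob (B n) \<le> prob (E n)) F"
    using sub
  proof eventually_elim
    case (elim n)
    have "prob (space M - B n) \<le> prob (E n)" by (rule finite_measure_mono[OF elim E])
    then show ?case using prob_compl[OF B] by simp
  qed
  show "((\<lambda>n. 1 - prob (B n)) \<longlongrightarrow> 1) F" using tendsto_diff[OF tendsto_const lim, of 1] by simp
qed auto

theorem theorem2:
  fixes M :: "'a measure" and eps :: "nat \<Rightarrow> 'a \<Rightarrow> real"
    and \<mu> :: real and \<delta> :: "nat \<Rightarrow> real" and \<tau> :: "nat \<Rightarrow> nat"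
    and \<sigma> :: "real \<Rightarrow> real" and \<zeta> :: real
    and Y :: "nat \<Rightarrow> nat \<Rightarrow> 'a \<Rightarrow> real"
  assumes "prob_space M"
    and E: "assumption_E M (\<lambda>i. eps (Suc i))"
    and V: "assumption_V \<sigma>"
    and C: "filterlim (\<lambda>n. \<bar>\<delta> n\<bar> * sqrt (real n)) at_top sequentially"
    and zeta: "0 < \<zeta>" "\<zeta> < 1"
    and tau: "\<And>n. \<tau> n = nat \<lfloor>real n * \<zeta>\<rfloor>"
    and H1: "\<And>n. \<delta> n \<noteq> 0"
    and Y_def: "\<And>n k \<omega>. Y n k \<omega> =
        \<mu> + \<delta> n * (if k > \<tau> n then 1 else 0) + \<sigma> (real k / real n) * eps k \<omega>"
  shows "(\<forall>c::real. (\<lambda>n. measure M {\<omega> \<in> space M. c < Q_stat n (partial_sum (\<lambda>k. Y n k \<omega>))})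
                  \<longlonglongrightarrow> 1) \<and>
         (\<forall>c::real. (\<lambda>n. measure M {\<omega> \<in> space M. c < R_stat n (partial_sum (\<lambda>k. Y n k \<omega>))})
                  \<longlonglongrightarrow> 1)"
proof -
  interpret prob_space M by fact
  define X where "X = (\<lambda>i. eps (Suc i))"
  obtain c0 where "short_range_process M X c0"
    using assumption_E_imp_short_range_process[of X] E unfolding X_def by blast
  then interpret short_range_process M X c0 .
  obtain B where B: "0 < B" "\<And>x. x \<in> {0..1} \<Longrightarrow> \<bar>\<sigma> x\<bar> \<le> B" using assumption_V_bounded[OF V] by blast
  \<comment> \<open>The noise \<open>X i\<close> is \<open>eps (Suc i)\<close>, so its weight is
    \<sigma> at \<open>Suc i / n\<close>, and \<open>T n k\<close> collects the noise of
    observations 1 to \<open>k\<close>.\<close>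
  define T where "T = (\<lambda>n k \<omega>. \<Sum>i\<in>{..<k}. \<sigma> (real (Suc i) / real n) * X i \<omega>)"
  have [measurable]: "T n k \<in> borel_measurable M" for n k unfolding T_def by measurable
  have v: "partial_sum (\<lambda>k. Y n k \<omega>) k = real k * \<mu> + \<delta> n * real (k - \<tau> n) + T n k \<omega>" for n k \<omega>
  proof (induction k)
    case (Suc k)
    have "real (Suc k - \<tau> n) = real (k - \<tau> n) + (if Suc k > \<tau> n then 1 else 0)"
      by (auto simp: Suc_diff_le)
    with Suc show ?case by (simp add: partial_sum_def Y_def T_def X_def algebra_simps)
  qed (simp add: partial_sum_def T_def)
  have vm: "(\<lambda>\<omega>. partial_sum (\<lambda>k. Y n k \<omega>) k) \<in> borel_measurable M" for n k
    unfolding v by measurable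
  have Qm: "{\<omega> \<in> space M. c < Q_stat n (partial_sum (\<lambda>k. Y n k \<omega>))} \<in> sets M" for n c
  proof -
    have [measurable]: "(\<lambda>\<omega>. Q_stat n (partial_sum (\<lambda>k. Y n k \<omega>))) \<in> borel_measurable M"
      by (rule borel_measurable_Q_stat[OF vm])
    show ?thesis by measurable
  qed
  have Rm: "{\<omega> \<in> space M. c < R_stat n (partial_sum (\<lambda>k. Y n k \<omega>))} \<in> sets M" for n c
  proof -
    have [measurable]: "(\<lambda>\<omega>. R_stat n (partial_sum (\<lambda>k. Y n k \<omega>))) \<in> borel_measurable M"
      by (rule borel_measurable_R_stat[OF vm])
    show ?thesis by measurable
  qed

  \<comment> \<open>For each level \<open>c\<close> a single exceptional event, that some noise
    partial sum is too large, serves both statistics.\<close>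
  have main: "\<exists>Bad. (\<forall>n. Bad n \<in> sets M) \<and> (\<lambda>n. prob (Bad n)) \<longlonglongrightarrow> 0 \<and>
    (\<forall>\<^sub>F n in sequentially. \<forall>\<omega>\<in>space M - Bad n.
      c < Q_stat n (partial_sum (\<lambda>k. Y n k \<omega>)) \<and> c < R_stat n (partial_sum (\<lambda>k. Y n k \<omega>)))" for c
  proof -
    \<comment> \<open>For large \<open>n\<close> the whole window lies above
      \<open>\<zeta> * n / 2\<close>, and at least \<open>(1 - \<zeta>) * n\<close> observations
      follow the change; \<kappa> is the product of these two fractions.\<close>
    define \<kappa> where "\<kappa> = \<zeta> / 2 * (1 - \<zeta>)"
    \<comment> \<open>The three bounds keep the window short compared with
      \<open>\<zeta> * n\<close>, let the signal dominate the noise, and push the lower bound for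
      \<open>R_stat\<close> above \<open>c\<close>. Because \<open>\<kappa> \<le> 1\<close>, the
      last one also handles \<open>Q_stat\<close>.\<close>
    define \<eta> where "\<eta> = min (\<zeta> / 4) (min (\<kappa> / 4) (\<kappa>\<^sup>2 / (200 * (\<bar>c\<bar> + 1))))"
    have \<kappa>: "0 < \<kappa>" "\<kappa> \<le> 1" using zeta mult_mono[of "\<zeta> / 2" 1 "1 - \<zeta>" 1] by (auto simp: \<kappa>_def)
    have \<eta>: "0 < \<eta>" "\<eta> \<le> \<zeta> / 4" "4 * \<eta> \<le> \<kappa>" "\<eta> \<le> \<kappa>\<^sup>2 / (200 * (\<bar>c\<bar> + 1))"
    proof -
      show "0 < \<eta>" using zeta \<kappa> by (simp add: \<eta>_def)
      show "\<eta> \<le> \<zeta> / 4" unfolding \<eta>_def by linarith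
      have "\<eta> \<le> \<kappa> / 4" unfolding \<eta>_def by linarith
      then show "4 * \<eta> \<le> \<kappa>" by simp
      show "\<eta> \<le> \<kappa>\<^sup>2 / (200 * (\<bar>c\<bar> + 1))" unfolding \<eta>_def by linarith
    qed
    have cR: "c < \<kappa>\<^sup>2 / (200 * \<eta>)"
    proof -
      have "(\<bar>c\<bar> + 1) * (200 * \<eta>) \<le> \<kappa>\<^sup>2" using \<eta>(4) by (simp add: field_simps)
      then have "\<bar>c\<bar> + 1 \<le> \<kappa>\<^sup>2 / (200 * \<eta>)" using \<eta>(1) by (simp add: le_divide_eq)
      then show ?thesis by linarith
    qed
    have cQ: "c < \<kappa> / (20 * \<eta>)"
    proof -
      have "\<kappa>\<^sup>2 \<le> \<kappa> * 1" unfolding power2_eq_square by (rule mult_left_mono) (use \<kappa> in auto)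
      then have "\<kappa>\<^sup>2 / (200 * \<eta>) \<le> \<kappa> / (20 * \<eta>)" using \<eta>(1) \<kappa> by (intro frac_le) auto
      then show ?thesis using cR by linarith
    qed
    define y where "y = (\<lambda>n. \<eta> * \<bar>\<delta> n\<bar> * real n)"
    define Bad where "Bad = (\<lambda>n. {\<omega> \<in> space M. \<exists>k\<in>{..n}. y n < \<bar>T n k \<omega>\<bar>})"
    have "Bad n \<in> sets M" for n unfolding Bad_def by measurable
    moreover have "(\<lambda>n. prob (Bad n)) \<longlonglongrightarrow> 0"
    proof -
      define K where "K = 36 * suminf c0 + 256 * (\<Sum>j. real j * alpha_mix M X j) + 16"
      note maximal = maximal_inequality[folded K_def]
      have bound: "prob (Bad n) \<le> 9 * K * B\<^sup>2 / \<eta>\<^sup>2 * inverse ((\<bar>\<delta> n\<bar> * sqrt (real n))\<^sup>2)" if n: "0 < n" for n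
      proof -
        \<comment> \<open>Dividing by the bound \<open>B\<close> of \<sigma> gives weights of
          absolute value at most 1. The level \<open>y n\<close> becomes
          \<open>y n / (3 * B)\<close>, which also absorbs the factor 3 of the maximal
          inequality.\<close>
        define w where "w = (\<lambda>i. \<sigma> (real (Suc i) / real n) / B)"
        have w: "\<bar>w i\<bar> \<le> 1" if "i < n" for i
          using B(2)[of "real (Suc i) / real n"] that B(1) by (simp add: w_def divide_le_eq)
        have Tw: "T n k \<omega> = B * partial w {..<k} \<omega>" for k \<omega>
          using B(1) by (simp add: T_def w_def sum_distrib_left)
        have y0: "0 < y n" using \<eta> H1 n by (simp add: y_def)
        have "3 * (y n / (3 * B)) < \<bar>partial w {..<k} \<omega>\<bar> \<longleftrightarrow> y n < \<bar>T n k \<omega>\<bar>" for k \<omega>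
          using B(1) by (simp add: Tw abs_mult divide_less_eq mult.commute)
        then have eq: "Bad n = {\<omega> \<in> space M. \<exists>k\<le>n. 3 * (y n / (3 * B)) < \<bar>partial w {..<k} \<omega>\<bar>}"
          by (simp only: Bad_def atMost_iff Bex_def)
        have "prob (Bad n) \<le> K * real n / (y n / (3 * B))\<^sup>2"
          unfolding eq by (rule maximal[OF w]) (use y0 B(1) in auto)
        also have "\<dots> = 9 * K * B\<^sup>2 / \<eta>\<^sup>2 * inverse (\<bar>\<delta> n\<bar>\<^sup>2 * real n)"
          using n B(1) \<eta>(1) H1[of n] by (simp add: y_def field_simps power2_eq_square)
        also have "\<bar>\<delta> n\<bar>\<^sup>2 * real n = (\<bar>\<delta> n\<bar> * sqrt (real n))\<^sup>2"
          by (simp add: power_mult_distrib)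
        finally show ?thesis .
      qed
      have "filterlim (\<lambda>n. (\<bar>\<delta> n\<bar> * sqrt (real n))\<^sup>2) at_top sequentially"
        by (rule filterlim_pow_at_top[OF _ C]) simp
      then have "(\<lambda>n. inverse ((\<bar>\<delta> n\<bar> * sqrt (real n))\<^sup>2)) \<longlonglongrightarrow> 0"
        by (rule tendsto_inverse_0_at_top)
      then have lim: "(\<lambda>n. 9 * K * B\<^sup>2 / \<eta>\<^sup>2 * inverse ((\<bar>\<delta> n\<bar> * sqrt (real n))\<^sup>2)) \<longlonglongrightarrow> 0"
        by (rule tendsto_mult_right_zero)
      show ?thesis
      proof (rule tendsto_sandwich[OF _ _ tendsto_const lim])
        show "\<forall>\<^sub>F n in sequentially. prob (Bad n) \<le> 9 * K * B\<^sup>2 / \<eta>\<^sup>2 * inverse ((\<bar>\<delta> n\<bar> * sqrt (real n))\<^sup>2)"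
          by (rule eventually_mono[OF eventually_gt_at_top[of 0]]) (rule bound)
      qed simp
    qed
    moreover have "\<forall>\<^sub>F n in sequentially. \<forall>\<omega>\<in>space M - Bad n.
        c < Q_stat n (partial_sum (\<lambda>k. Y n k \<omega>)) \<and> c < R_stat n (partial_sum (\<lambda>k. Y n k \<omega>))"
    proof -
      \<comment> \<open>\<open>n \<ge> 2 / \<eta>\<close> ensures that rounding leaves
        \<open>m \<ge> 1\<close> and loses at most half of \<open>\<eta> * n\<close>;
        \<open>n \<ge> 4 / \<zeta>\<close> absorbs the rounding of \<open>\<tau> n\<close> in the
        bound \<open>\<zeta> / 2 * n \<le> \<tau> n - m\<close>.\<close>
      have "\<forall>\<^sub>F n in sequentially. max (2 / \<eta>) (4 / \<zeta>) \<le> real n"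
        using filterlim_real_sequentially unfolding filterlim_at_top by blast
      then show ?thesis
      proof eventually_elim
        case (elim n)
        have "2 / \<eta> \<le> real n" "4 / \<zeta> \<le> real n" using elim by linarith+
        then have n2: "2 \<le> \<eta> * real n" "4 \<le> \<zeta> * real n"
          using \<eta>(1) zeta(1) by (simp_all add: divide_le_eq mult.commute)
        then have n0: "0 < real n" by (cases n) auto
        define m where "m = nat \<lfloor>\<eta> * real n\<rfloor>"
        have "real m = of_int \<lfloor>\<eta> * real n\<rfloor>" using n2 by (simp add: m_def)
        then have m: "real m \<le> \<eta> * real n" "\<eta> * real n < real m + 1" by linarith+
        then have m': "1 \<le> m" "\<eta> * real n \<le> 2 * real m" using n2 by linarith+
        have "real (\<tau> n) = of_int \<lfloor>real n * \<zeta>\<rfloor>" using zeta by (simp add: tau)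
        then have t: "real (\<tau> n) \<le> \<zeta> * real n" "\<zeta> * real n < real (\<tau> n) + 1"
          using of_int_floor_le[of "real n * \<zeta>"] real_of_int_floor_add_one_gt[of "real n * \<zeta>"]
          by (simp_all only: mult.commute[of \<zeta>])
        have "\<zeta> * real n < 1 * real n" by (rule mult_strict_right_mono) (use zeta n0 in auto)
        then have tn: "\<tau> n < n" using t by linarith
        have "\<eta> * real n \<le> \<zeta> / 4 * real n" by (rule mult_right_mono) (use \<eta> in auto)
        then have tm: "\<zeta> / 2 * real n \<le> real (\<tau> n) - real m" using m t n2 by simp
        then have mt: "m < \<tau> n" using n2 by simp
        have "\<zeta> / 2 * real n * ((1 - \<zeta>) * real n) \<le> real (\<tau> n - m) * real (n - \<tau> n)"
          by (rule mult_mono) (use tm mt tn t zeta in \<open>auto simp: algebra_simps of_nat_diff\<close>)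
        then have k: "\<kappa> * real n \<le> real (\<tau> n - m) * real (n - \<tau> n) / real n"
          using n0 by (simp add: \<kappa>_def le_divide_eq mult_ac)
        show ?case
        proof (intro ballI)
          fix \<omega> assume "\<omega> \<in> space M - Bad n"
          then have T: "\<bar>T n j \<omega>\<bar> \<le> \<eta> * \<bar>\<delta> n\<bar> * real n" if "j \<le> n" for j
            using that by (force simp: Bad_def y_def not_less)
          note b = Q_R_stat_change_point_bound[OF v T mt tn k m'(1) m(1) m'(2) \<eta>(1,3) H1]
          show "c < Q_stat n (partial_sum (\<lambda>k. Y n k \<omega>)) \<and> c < R_stat n (partial_sum (\<lambda>k. Y n k \<omega>))"
            using b cQ cR by (blast intro: less_le_trans)
        qed
      qed
    qed
    ultimately show ?thesis by blast
  qed
  show ?thesis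
  proof (intro conjI allI)
    fix c :: real
    obtain Bad where Bad: "\<And>n. Bad n \<in> sets M" "(\<lambda>n. prob (Bad n)) \<longlonglongrightarrow> 0"
      "\<forall>\<^sub>F n in sequentially. \<forall>\<omega>\<in>space M - Bad n.
        c < Q_stat n (partial_sum (\<lambda>k. Y n k \<omega>)) \<and> c < R_stat n (partial_sum (\<lambda>k. Y n k \<omega>))"
      using main[of c] by blast
    show "(\<lambda>n. prob {\<omega> \<in> space M. c < Q_stat n (partial_sum (\<lambda>k. Y n k \<omega>))}) \<longlonglongrightarrow> 1"
      by (rule prob_tendsto_1[OF Qm Bad(1) _ Bad(2)], rule eventually_mono[OF Bad(3)]) blast
    show "(\<lambda>n. prob {\<omega> \<in> space M. c < R_stat n (partial_sum (\<lambda>k. Y n k \<omega>))}) \<longlonglongrightarrow> 1"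
      by (rule prob_tendsto_1[OF Rm Bad(1) _ Bad(2)], rule eventually_mono[OF Bad(3)]) blast
  qed
qed

end
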